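(* Let $\mathcal X$ and $\mathcal Y$ be nonzero Banach spaces over $\mathbb F$ and let $\mathcal M$ and $\mathcal N$ be nonzero (closed) subspaces of $\mathcal X$ and $\mathcal Y$, respectively. Then the following assertions are pairwise equivalent. (a) $\mathcal M\otimes_\wedge\mathcal N$ is a linear manifold of $\mathcal X\otimes_\wedge\mathcal Y$. (b) Every bounded bilinear form $\phi:\mathcal M\times\mathcal N\to\mathbb F$ has a bounded bilinear extension $\widehat\phi:\mathcal X\times\mathcal Y\to\mathbb F$ with $\|\widehat\phi\|=\|\phi\|$. (c) Every bounded linear form $f:\mathcal M\otimes_\wedge\mathcal N\to\mathbb F$ has a bounded linear extension $\widetilde f:\mathcal X\otimes_\wedge\mathcal Y\to\mathbb F$ with $\|\widetilde f\|=\|f\|$. (d) Every bounded linear form $\overline f:\mathcal M\widehat\otimes_\wedge\mathcal N\to\mathbb F$ has a bounded linear extension $\widehat f:\mathcal X\widehat\otimes_\wedge\mathcal Y\to\mathbb F$ with $\|\widehat f\|=\|\overline f\|$.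
   Context: $\mathbb F$ is either the real or the complex field; all linear spaces are over the same $\mathbb F$. A linear manifold is a (not necessarily closed) linear subspace with the inherited norm; a subspace means a closed linear manifold. A bilinear form $\phi$ is bounded if $\|\phi\|=\sup_{x\ne0,\,y\ne0}\frac{|\phi(x,y)|}{\|x\|\,\|y\|}<\infty$. $\mathcal X\otimes\mathcal Y$ is the algebraic tensor product; $\mathcal X\otimes_\wedge\mathcal Y$ is $\mathcal X\otimes\mathcal Y$ equipped with the projective norm $\|F\|_\wedge=\inf\sum_i\|x_i\|\,\|y_i\|$, the infimum being over all finite representations $F=\sum_i x_i\otimes y_i$ with $x_i\in\mathcal X$, $y_i\in\mathcal Y$; $\mathcal X\widehat\otimes_\wedge\mathcal Y$ is its completion. The space $\mathcal M\otimes_\wedge\mathcal N$ is defined in the same way from $\mathcal M$ and $\mathcal N$ (the infimum being over representations with $x_i\in\mathcal M$, $y_i\in\mathcal N$), and $\mathcal M\widehat\otimes_\wedge\mathcal N$ is its completion. Algebraically $\mathcal M\otimes\mathcal N$ is a linear subspace of $\mathcal X\otimes\mathcal Y$ in the natural way. "$\mathcal M\otimes_\wedge\mathcal N$ is a linear manifold of $\mathcal X\otimes_\wedge\mathcal Y$" means that the norms agree: $\|F\|_{\mathcal X\otimes_\wedge\mathcal Y}=\|F\|_{\mathcal M\otimes_\wedge\mathcal N}$ for every $F\in\mathcal M\otimes\mathcal N$. Extensions: in (b), $\widehat\phi|_{\mathcal M\times\mathcal N}=\phi$; in (c), $\widetilde f$ agrees with $f$ on $\mathcal M\otimes\mathcal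 N$; in (d), $\widehat f\circ\iota=\overline f$, where $\iota:\mathcal M\widehat\otimes_\wedge\mathcal N\to\mathcal X\widehat\otimes_\wedge\mathcal Y$ is the canonical bounded linear map, i.e. the continuous extension of the inclusion $\mathcal M\otimes\mathcal N\subseteq\mathcal X\otimes\mathcal Y$. *)

theory Defs
  imports "HOL-Analysis.Analysis" "HOL-Library.Function_Algebras"
begin

text \<open>
  A scalar field that is either the real or the complex field.  The second alternative
  says that the type is a copy of the complex numbers with their usual absolute value.
\<close>

class real_or_complex = real_normed_field +
  assumes real_or_complex:
    "(\<forall>z. \<exists>r. z = r *\<^sub>R 1) \<or>
     (\<exists>j. j * j = - 1 \<and>
        (\<forall>z. \<exists>a b. z = a *\<^sub>R 1 + b *\<^sub>R j) \<and>
        (\<forall>a b. norm (a *\<^sub>R 1 + b *\<^sub>R j) = sqrt (a\<^sup>2 + b\<^sup>2)))"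

instance real :: real_or_complex
  by standard auto

instance complex :: real_or_complex
proof
  have "imaginary_unit * imaginary_unit = - 1 \<and>
        (\<forall>z. \<exists>a b. z = a *\<^sub>R 1 + b *\<^sub>R imaginary_unit) \<and>
        (\<forall>a b. norm (a *\<^sub>R 1 + b *\<^sub>R imaginary_unit) = sqrt (a\<^sup>2 + b\<^sup>2))"
  proof (intro conjI allI)
    fix z :: complex
    show "\<exists>a b. z = a *\<^sub>R 1 + b *\<^sub>R imaginary_unit"
      by (rule exI[of _ "Re z"], rule exI[of _ "Im z"]) (simp add: complex_eq_iff)
  qed (simp_all add: cmod_def)
  then show "(\<forall>z::complex. \<exists>r. z = r *\<^sub>R 1) \<or>
     (\<exists>j::complex. j * j = - 1 \<and>
        (\<forall>z. \<exists>a b. z = a *\<^sub>R 1 + b *\<^sub>R j) \<and>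
        (\<forall>a b. norm (a *\<^sub>R 1 + b *\<^sub>R j) = sqrt (a\<^sup>2 + b\<^sup>2)))"
    by blast
qed

text \<open>
  A normed space over \<open>'k\<close>: the norm is that of the underlying real normed space, and
  the scalar multiplication \<open>scale\<close> extends the real one.  A Banach space over \<open>'k\<close> is
  such a space on a type of class \<^class>\<open>banach\<close>.
\<close>

locale normed_space_over = vector_space scale
  for scale :: "'k::real_or_complex \<Rightarrow> 'a::real_normed_vector \<Rightarrow> 'a" +
  assumes scale_of_real: "scale (of_real r) x = r *\<^sub>R x"
    and norm_scale: "norm (scale c x) = norm c * norm x"


subsection \<open>Bilinear forms on a product of linear manifolds\<close>

definition bilinear_form_on ::
    "('k::field \<Rightarrow> 'x::ab_group_add \<Rightarrow> 'x) \<Rightarrow> ('k \<Rightarrow> 'y::ab_group_add \<Rightarrow> 'y) \<Rightarrow>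
     'x set \<Rightarrow> 'y set \<Rightarrow> ('x \<Rightarrow> 'y \<Rightarrow> 'k) \<Rightarrow> bool" where
  "bilinear_form_on sX sY A B \<phi> \<longleftrightarrow>
     (\<forall>x\<in>A. \<forall>x'\<in>A. \<forall>y\<in>B. \<phi> (x + x') y = \<phi> x y + \<phi> x' y) \<and>
     (\<forall>x\<in>A. \<forall>y\<in>B. \<forall>y'\<in>B. \<phi> x (y + y') = \<phi> x y + \<phi> x y') \<and>
     (\<forall>c. \<forall>x\<in>A. \<forall>y\<in>B. \<phi> (sX c x) y = c * \<phi> x y \<and> \<phi> x (sY c y) = c * \<phi> x y)"

definition bilinear_quotients ::
    "'x::real_normed_vector set \<Rightarrow> 'y::real_normed_vector set \<Rightarrow>
     ('x \<Rightarrow> 'y \<Rightarrow> 'k::real_normed_vector) \<Rightarrow> real set" where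
  "bilinear_quotients A B \<phi> =
     {norm (\<phi> x y) / (norm x * norm y) | x y. x \<in> A - {0} \<and> y \<in> B - {0}}"

definition bounded_bilinear_form_on ::
    "('k::real_normed_field \<Rightarrow> 'x::real_normed_vector \<Rightarrow> 'x) \<Rightarrow>
     ('k \<Rightarrow> 'y::real_normed_vector \<Rightarrow> 'y) \<Rightarrow> 'x set \<Rightarrow> 'y set \<Rightarrow> ('x \<Rightarrow> 'y \<Rightarrow> 'k) \<Rightarrow> bool" where
  "bounded_bilinear_form_on sX sY A B \<phi> \<longleftrightarrow>
     bilinear_form_on sX sY A B \<phi> \<and> bdd_above (bilinear_quotients A B \<phi>)"

definition bilinear_form_norm ::
    "'x::real_normed_vector set \<Rightarrow> 'y::real_normed_vector set \<Rightarrow>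
     ('x \<Rightarrow> 'y \<Rightarrow> 'k::real_normed_vector) \<Rightarrow> real" where
  "bilinear_form_norm A B \<phi> = Sup (bilinear_quotients A B \<phi>)"


subsection \<open>Normed spaces with explicit operations, and linear forms on them\<close>

record ('k, 'v) nspace =
  points :: "'v set"
  vadd :: "'v \<Rightarrow> 'v \<Rightarrow> 'v"
  vzero :: 'v
  vscale :: "'k \<Rightarrow> 'v \<Rightarrow> 'v"
  vnorm :: "'v \<Rightarrow> real"

definition linear_form_on :: "('k::field, 'v) nspace \<Rightarrow> ('v \<Rightarrow> 'k) \<Rightarrow> bool" where
  "linear_form_on E f \<longleftrightarrow>
     (\<forall>u\<in>points E. \<forall>v\<in>points E. f (vadd E u v) = f u + f v) \<and>
     (\<forall>c. \<forall>v\<in>points E. f (vscale E c v) = c * f v)"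

definition form_quotients ::
    "('k::real_normed_field, 'v) nspace \<Rightarrow> ('v \<Rightarrow> 'k) \<Rightarrow> real set" where
  "form_quotients E f = {norm (f v) / vnorm E v | v. v \<in> points E - {vzero E}}"

definition bounded_linear_form_on ::
    "('k::real_normed_field, 'v) nspace \<Rightarrow> ('v \<Rightarrow> 'k) \<Rightarrow> bool" where
  "bounded_linear_form_on E f \<longleftrightarrow> linear_form_on E f \<and> bdd_above (form_quotients E f)"

definition form_norm :: "('k::real_normed_field, 'v) nspace \<Rightarrow> ('v \<Rightarrow> 'k) \<Rightarrow> real" where
  "form_norm E f = Sup (form_quotients E f)"


subsection \<open>The algebraic tensor product and the projective norm\<close>

text \<open>
  The tensor product of \<open>'x\<close> and \<open>'y\<close> is realized inside the algebraic dual of the space of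
  bilinear forms: \<open>x \<otimes> y\<close> is evaluation at \<open>(x, y)\<close>.  For linear manifolds \<open>A\<close> and \<open>B\<close>,
  the tensor product of \<open>A\<close> and \<open>B\<close> is the span of the \<open>x \<otimes> y\<close> with \<open>x \<in> A\<close>, \<open>y \<in> B\<close>; it is
  thereby a linear subspace of the tensor product of \<open>'x\<close> and \<open>'y\<close>.  Lemma
  \<open>algebraic_tensor_universal\<close> below confirms that this span is a tensor product of \<open>A\<close> and
  \<open>B\<close> in their own right.
\<close>

type_synonym ('k, 'x, 'y) tensor = "('x \<Rightarrow> 'y \<Rightarrow> 'k) \<Rightarrow> 'k"

definition simple_tensor ::
    "('k::field \<Rightarrow> 'x::ab_group_add \<Rightarrow> 'x) \<Rightarrow> ('k \<Rightarrow> 'y::ab_group_add \<Rightarrow> 'y) \<Rightarrow>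
     'x \<Rightarrow> 'y \<Rightarrow> ('k, 'x, 'y) tensor" where
  "simple_tensor sX sY x y = (\<lambda>\<phi>. if bilinear_form_on sX sY UNIV UNIV \<phi> then \<phi> x y else 0)"

definition tensor_scale :: "'k::field \<Rightarrow> ('k, 'x, 'y) tensor \<Rightarrow> ('k, 'x, 'y) tensor" where
  "tensor_scale c F = (\<lambda>\<phi>. c * F \<phi>)"

definition algebraic_tensor ::
    "('k::field \<Rightarrow> 'x::ab_group_add \<Rightarrow> 'x) \<Rightarrow> ('k \<Rightarrow> 'y::ab_group_add \<Rightarrow> 'y) \<Rightarrow>
     'x set \<Rightarrow> 'y set \<Rightarrow> ('k, 'x, 'y) tensor set" where
  "algebraic_tensor sX sY A B =
     module.span tensor_scale {simple_tensor sX sY x y | x y. x \<in> A \<and> y \<in> B}"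

lemma vector_space_tensor_scale: "vector_space (tensor_scale :: 'k::field \<Rightarrow> ('k, 'x, 'y) tensor \<Rightarrow> _)"
  by standard (auto simp: tensor_scale_def fun_eq_iff algebra_simps)

lemma algebraic_tensor_universal:
  fixes sX :: "'k::field \<Rightarrow> 'x::ab_group_add \<Rightarrow> 'x" and sY :: "'k \<Rightarrow> 'y::ab_group_add \<Rightarrow> 'y"
  assumes X: "vector_space sX" and Y: "vector_space sY"
    and A: "module.subspace sX A" and B: "module.subspace sY B"
    and \<phi>: "bilinear_form_on sX sY A B \<phi>"
  obtains f where "Vector_Spaces.linear tensor_scale (*) f"
    and "\<And>x y. x \<in> A \<Longrightarrow> y \<in> B \<Longrightarrow> f (simple_tensor sX sY x y) = \<phi> x y"
proof -
  interpret X: vector_space sX by fact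
  interpret Y: vector_space sY by fact
  interpret XX: vector_space_pair sX sX ..
  interpret YY: vector_space_pair sY sY ..
  obtain p where p: "range p \<subseteq> A" "Vector_Spaces.linear sX sX p" "\<And>x. x \<in> A \<Longrightarrow> p x = x"
    using XX.linear_exists_left_inverse_on[OF X.linear_id A] by auto
  obtain q where q: "range q \<subseteq> B" "Vector_Spaces.linear sY sY q" "\<And>y. y \<in> B \<Longrightarrow> q y = y"
    using YY.linear_exists_left_inverse_on[OF Y.linear_id B] by auto
  interpret p: Vector_Spaces.linear sX sX p by fact
  interpret q: Vector_Spaces.linear sY sY q by fact
  have pq: "p x \<in> A" "q y \<in> B" for x y using p(1) q(1) by auto
  define \<psi> where "\<psi> = (\<lambda>x y. \<phi> (p x) (q y))"
  have \<psi>: "bilinear_form_on sX sY UNIV UNIV \<psi>"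
    using \<phi> pq by (simp add: bilinear_form_on_def \<psi>_def p.add q.add p.scale q.scale)
  show thesis
  proof
    show "Vector_Spaces.linear tensor_scale (*) (\<lambda>F::('k, 'x, 'y) tensor. F \<psi>)"
      unfolding Vector_Spaces.linear_def module_hom_def module_hom_axioms_def
        module_iff_vector_space
      using vector_space_tensor_scale
      by (auto simp: tensor_scale_def intro!: vector_space.intro) (auto simp: algebra_simps)
    show "simple_tensor sX sY x y \<psi> = \<phi> x y" if "x \<in> A" "y \<in> B" for x y
      using that \<psi> by (simp add: simple_tensor_def \<psi>_def p(3) q(3))
  qed
qed

definition projective_norm ::
    "('k::field \<Rightarrow> 'x::real_normed_vector \<Rightarrow> 'x) \<Rightarrow> ('k \<Rightarrow> 'y::real_normed_vector \<Rightarrow> 'y) \<Rightarrow>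
     'x set \<Rightarrow> 'y set \<Rightarrow> ('k, 'x, 'y) tensor \<Rightarrow> real" where
  "projective_norm sX sY A B F =
     Inf {(\<Sum>(x, y)\<leftarrow>ps. norm x * norm y) | ps.
            set ps \<subseteq> A \<times> B \<and> F = (\<Sum>(x, y)\<leftarrow>ps. simple_tensor sX sY x y)}"

definition projective_tensor ::
    "('k::field \<Rightarrow> 'x::real_normed_vector \<Rightarrow> 'x) \<Rightarrow> ('k \<Rightarrow> 'y::real_normed_vector \<Rightarrow> 'y) \<Rightarrow>
     'x set \<Rightarrow> 'y set \<Rightarrow> ('k, ('k, 'x, 'y) tensor) nspace" where
  "projective_tensor sX sY A B =
     \<lparr>points = algebraic_tensor sX sY A B, vadd = (+), vzero = 0, vscale = tensor_scale,
      vnorm = projective_norm sX sY A B\<rparr>"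


subsection \<open>Completion\<close>

text \<open>
  The completion consists of the classes of Cauchy sequences modulo null sequences.
\<close>

definition vdist :: "('k::field, 'v) nspace \<Rightarrow> 'v \<Rightarrow> 'v \<Rightarrow> real" where
  "vdist E u v = vnorm E (vadd E u (vscale E (- 1) v))"

definition cauchy_seqs :: "('k::field, 'v) nspace \<Rightarrow> (nat \<Rightarrow> 'v) set" where
  "cauchy_seqs E =
     {s. range s \<subseteq> points E \<and> (\<forall>e>0. \<exists>n0. \<forall>m\<ge>n0. \<forall>n\<ge>n0. vdist E (s m) (s n) < e)}"

definition cauchy_rel :: "('k::field, 'v) nspace \<Rightarrow> ((nat \<Rightarrow> 'v) \<times> (nat \<Rightarrow> 'v)) set" where
  "cauchy_rel E =
     {(s, t). s \<in> cauchy_seqs E \<and> t \<in> cauchy_seqs E \<and> (\<lambda>n. vdist E (s n) (t n)) \<longlonglongrightarrow> 0}"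

definition nspace_completion :: "('k::field, 'v) nspace \<Rightarrow> ('k, (nat \<Rightarrow> 'v) set) nspace" where
  "nspace_completion E =
     \<lparr>points = cauchy_seqs E // cauchy_rel E,
      vadd = (\<lambda>P Q. \<Union>s\<in>P. \<Union>t\<in>Q. cauchy_rel E `` {\<lambda>n. vadd E (s n) (t n)}),
      vzero = cauchy_rel E `` {\<lambda>n. vzero E},
      vscale = (\<lambda>c P. \<Union>s\<in>P. cauchy_rel E `` {\<lambda>n. vscale E c (s n)}),
      vnorm = (\<lambda>P. THE r. \<forall>s\<in>P. (\<lambda>n. vnorm E (s n)) \<longlonglongrightarrow> r)\<rparr>"

text \<open>
  The continuous extension \<open>nspace_completion MN \<rightarrow> nspace_completion XY\<close> of the inclusion of \<open>MN\<close> into \<open>XY\<close>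
  sends the class of a Cauchy sequence of \<open>MN\<close> to its class in the completion of \<open>XY\<close>, which is
  the image of the former class under the relation \<open>cauchy_rel XY\<close>; see lemma
  \<open>completion_inclusion_class\<close>.
\<close>

definition completion_inclusion ::
    "('k::field, 'v) nspace \<Rightarrow> (nat \<Rightarrow> 'v) set \<Rightarrow> (nat \<Rightarrow> 'v) set" where
  "completion_inclusion E P = cauchy_rel E `` P"

lemma algebraic_tensor_rep:
  fixes sX :: "'k::field \<Rightarrow> 'x::ab_group_add \<Rightarrow> 'x" and sY :: "'k \<Rightarrow> 'y::ab_group_add \<Rightarrow> 'y"
  assumes X: "vector_space sX" and Y: "vector_space sY" and A: "module.subspace sX A"
    and "F \<in> algebraic_tensor sX sY A B"
  shows "\<exists>ps. set ps \<subseteq> A \<times> B \<and> F = (\<Sum>(x, y)\<leftarrow>ps. simple_tensor sX sY x y)"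
proof -
  interpret T: vector_space "tensor_scale :: 'k \<Rightarrow> ('k, 'x, 'y) tensor \<Rightarrow> _"
    by (rule vector_space_tensor_scale)
  interpret X: vector_space sX by fact
  show ?thesis
    using assms(4) unfolding algebraic_tensor_def
  proof (induction rule: T.span_induct_alt)
    case base
    show ?case by (intro exI[of _ "[]"]) simp
  next
    case (step c G H)
    then obtain x y ps where *: "G = simple_tensor sX sY x y" "x \<in> A" "y \<in> B"
      "set ps \<subseteq> A \<times> B" "H = (\<Sum>(x, y)\<leftarrow>ps. simple_tensor sX sY x y)"
      by blast
    have "tensor_scale c G = simple_tensor sX sY (sX c x) y"
      by (auto simp: *(1) tensor_scale_def simple_tensor_def bilinear_form_on_def fun_eq_iff)
    then show ?case
      using * X.subspace_scale[OF A] by (intro exI[of _ "(sX c x, y) # ps"]) auto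
  qed
qed

lemma projective_norm_nonneg:
  assumes "vector_space sX" "vector_space sY" "module.subspace sX A"
    "F \<in> algebraic_tensor sX sY A B"
  shows "0 \<le> projective_norm sX sY A B F"
  unfolding projective_norm_def
  by (rule cInf_greatest)
    (use algebraic_tensor_rep[OF assms] in \<open>auto intro!: sum_list_nonneg\<close>)

lemma projective_norm_le:
  assumes "set ps \<subseteq> A \<times> B"
  shows "projective_norm sX sY A B (\<Sum>(x, y)\<leftarrow>ps. simple_tensor sX sY x y)
    \<le> (\<Sum>(x, y)\<leftarrow>ps. norm x * norm y)"
  unfolding projective_norm_def
  by (rule cInf_lower)
    (use assms in \<open>auto intro!: bdd_belowI[of _ 0] sum_list_nonneg\<close>)

lemma projective_norm_triangle:
  assumes XY: "vector_space sX" "vector_space sY" "module.subspace sX A"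
    and F: "F \<in> algebraic_tensor sX sY A B" and G: "G \<in> algebraic_tensor sX sY A B"
  shows "projective_norm sX sY A B (F + G)
    \<le> projective_norm sX sY A B F + projective_norm sX sY A B G"
proof -
  let ?t = "\<lambda>ps. \<Sum>(x, y)\<leftarrow>ps. simple_tensor sX sY x y"
  let ?n = "\<lambda>ps. \<Sum>(x, y)\<leftarrow>ps. norm x * norm y"
  let ?p = "projective_norm sX sY A B"
  have *: "?p (F + G) \<le> ?n ps + ?n qs"
    if "set ps \<subseteq> A \<times> B" "F = ?t ps" "set qs \<subseteq> A \<times> B" "G = ?t qs" for ps qs
    using projective_norm_le[of "ps @ qs" A B sX sY] that by simp
  have "?p (F + G) - ?n qs \<le> ?p F" if "set qs \<subseteq> A \<times> B" "G = ?t qs" for qs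
    unfolding projective_norm_def[of _ _ _ _ F]
  proof (rule cInf_greatest)
    show "{?n ps |ps. set ps \<subseteq> A \<times> B \<and> F = ?t ps} \<noteq> {}"
      using algebraic_tensor_rep[OF XY F] by blast
  qed (use *[OF _ _ that] in force)
  then have "?p (F + G) - ?p F \<le> ?n qs" if "set qs \<subseteq> A \<times> B" "G = ?t qs" for qs
    using that by force
  then have "?p (F + G) - ?p F \<le> ?p G"
    unfolding projective_norm_def[of _ _ _ _ G]
  proof (intro cInf_greatest)
    show "{?n qs |qs. set qs \<subseteq> A \<times> B \<and> G = ?t qs} \<noteq> {}"
      using algebraic_tensor_rep[OF XY G] by blast
  qed blast
  then show ?thesis by simp
qed

lemma projective_norm_mono:
  assumes "vector_space sX" "vector_space sY" "module.subspace sX A"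
    and "F \<in> algebraic_tensor sX sY A B" and "A \<subseteq> A'" "B \<subseteq> B'"
  shows "projective_norm sX sY A' B' F \<le> projective_norm sX sY A B F"
  unfolding projective_norm_def
proof (rule cInf_superset_mono)
  show "{\<Sum>(x, y)\<leftarrow>ps. norm x * norm y |ps.
      set ps \<subseteq> A \<times> B \<and> F = (\<Sum>(x, y)\<leftarrow>ps. simple_tensor sX sY x y)} \<noteq> {}"
    using algebraic_tensor_rep[OF assms(1-4)] by blast
  show "bdd_below {\<Sum>(x, y)\<leftarrow>ps. norm x * norm y |ps.
      set ps \<subseteq> A' \<times> B' \<and> F = (\<Sum>(x, y)\<leftarrow>ps. simple_tensor sX sY x y)}"
    by (auto intro!: bdd_belowI[of _ 0] sum_list_nonneg)
qed (use Sigma_mono[OF assms(5,6)] in blast)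

lemma completion_inclusion_class:
  fixes sX :: "'k::field \<Rightarrow> 'x::real_normed_vector \<Rightarrow> 'x"
    and sY :: "'k \<Rightarrow> 'y::real_normed_vector \<Rightarrow> 'y" and M :: "'x set" and N :: "'y set"
  assumes X: "vector_space sX" and Y: "vector_space sY" and M: "module.subspace sX M"
  defines "MN \<equiv> projective_tensor sX sY M N"
    and "XY \<equiv> projective_tensor sX sY UNIV UNIV"
  assumes s: "s \<in> cauchy_seqs MN"
  shows "s \<in> cauchy_seqs XY"
    and "completion_inclusion XY (cauchy_rel MN `` {s}) = cauchy_rel XY `` {s}"
proof -
  interpret T: vector_space "tensor_scale :: 'k \<Rightarrow> ('k, 'x, 'y) tensor \<Rightarrow> _"
    by (rule vector_space_tensor_scale)
  interpret X: vector_space sX by fact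
  note U = X.subspace_UNIV
  have d: "vdist MN F G = projective_norm sX sY M N (F - G)"
      "vdist XY F G = projective_norm sX sY UNIV UNIV (F - G)" for F G
    using T.scale_minus_left[of 1 G]
    by (simp_all add: vdist_def MN_def XY_def projective_tensor_def)
  have p: "points MN = algebraic_tensor sX sY M N" "points XY = algebraic_tensor sX sY UNIV UNIV"
    by (simp_all add: MN_def XY_def projective_tensor_def)
  have sub: "points MN \<subseteq> points XY"
    unfolding p algebraic_tensor_def by (rule T.span_mono) blast
  have diff: "F - G \<in> points E" if "F \<in> points E" "G \<in> points E" "E = MN \<or> E = XY" for E F G
    using that by (auto simp: p algebraic_tensor_def intro: T.span_diff)
  have le: "vdist XY F G \<le> vdist MN F G" if "F \<in> points MN" "G \<in> points MN" for F G
    unfolding d using diff[OF that] by (intro projective_norm_mono X Y M) (auto simp: p)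
  have nonneg: "0 \<le> vdist XY F G" if "F \<in> points XY" "G \<in> points XY" for F G
    unfolding d using diff[OF that] by (intro projective_norm_nonneg X Y U) (auto simp: p)
  have tri: "vdist XY F H \<le> vdist XY F G + vdist XY G H"
    if "F \<in> points XY" "G \<in> points XY" "H \<in> points XY" for F G H
    using projective_norm_triangle[OF X Y U, of "F - G" UNIV "G - H"] diff[OF that(1,2)] diff[OF that(2,3)]
    by (auto simp: d p)
  have refl: "vdist MN F F = 0" if "F \<in> points MN" for F
    using projective_norm_le[of "[]" M N sX sY] projective_norm_nonneg[OF X Y M, of 0 N]
      diff[OF that that] by (simp add: d p)
  have cauchy: "t \<in> cauchy_seqs XY" if tM: "t \<in> cauchy_seqs MN" for t
    unfolding cauchy_seqs_def
  proof (intro CollectI conjI allI impI)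
    have t: "t n \<in> points MN" for n using that by (auto simp: cauchy_seqs_def)
    show "range t \<subseteq> points XY" using t sub by auto
    fix e :: real assume "e > 0"
    then obtain n0 where "\<forall>m\<ge>n0. \<forall>n\<ge>n0. vdist MN (t m) (t n) < e"
      using tM unfolding cauchy_seqs_def by blast
    then show "\<exists>n0. \<forall>m\<ge>n0. \<forall>n\<ge>n0. vdist XY (t m) (t n) < e"
      using le[OF t t] by (meson le_less_trans)
  qed
  show "s \<in> cauchy_seqs XY" by (rule cauchy) fact
  have pt: "t n \<in> points E" if "t \<in> cauchy_seqs E" for E :: "('k, ('k, 'x, 'y) tensor) nspace" and t n
    using that by (auto simp: cauchy_seqs_def)
  have "(s, s) \<in> cauchy_rel MN"
    using s by (simp add: cauchy_rel_def refl pt)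
  moreover have "(s, w) \<in> cauchy_rel XY"
    if "(s, t) \<in> cauchy_rel MN" "(t, w) \<in> cauchy_rel XY" for t w
  proof -
    have m: "s \<in> cauchy_seqs MN" "t \<in> cauchy_seqs MN" "w \<in> cauchy_seqs XY"
      and l: "(\<lambda>n. vdist MN (s n) (t n)) \<longlonglongrightarrow> 0" "(\<lambda>n. vdist XY (t n) (w n)) \<longlonglongrightarrow> 0"
      using that by (auto simp: cauchy_rel_def)
    have "(\<lambda>n. vdist XY (s n) (w n)) \<longlonglongrightarrow> 0"
    proof (rule tendsto_sandwich)
      show "\<forall>\<^sub>F n in sequentially. 0 \<le> vdist XY (s n) (w n)"
        using nonneg pt cauchy m by auto
      show "\<forall>\<^sub>F n in sequentially. vdist XY (s n) (w n) \<le> vdist MN (s n) (t n) + vdist XY (t n) (w n)"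
        using tri[OF pt pt pt, OF cauchy cauchy] le[OF pt pt] m
        by (intro always_eventually allI) (meson add_right_mono order_trans)
      show "(\<lambda>n. vdist MN (s n) (t n) + vdist XY (t n) (w n)) \<longlonglongrightarrow> 0"
        using tendsto_add[OF l] by simp
    qed simp
    then show ?thesis using m cauchy by (simp add: cauchy_rel_def)
  qed
  ultimately show "completion_inclusion XY (cauchy_rel MN `` {s}) = cauchy_rel XY `` {s}"
    by (auto simp: completion_inclusion_def)
qed

end

theory Submission
  imports Defs
begin

text \<open>
The isometry statement and the extension statement for linear forms are two sides of the
Hahn-Banach theorem.  If the projective norm of the subspaces is the restriction of the projective
norm of the whole spaces, then a form on the small tensor product has the same bound for the large
norm and extends with it (\<open>hahn_banach\<close>).  If all forms extend with their norm, then a form that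
attains the small norm of a tensor \<open>F\<close> shows, once extended, that the large norm of \<open>F\<close> is not
smaller (\<open>isometric_iff_linear_extension\<close>).  The remaining two statements are translations of the
extension statement: bounded bilinear forms are the bounded linear forms on the projective tensor
product, with equal norms, and bounded linear forms on a normed space are those on its completion,
with equal norms.

Three points carry the proof.  First, the projective norm must be definite, since otherwise the
supremum of the quotients \<open>norm (f v) / vnorm E v\<close> does not control \<open>f\<close>.  By
\<open>product_forms_separate\<close> a nonzero tensor is detected by a product \<open>f x * g y\<close> of bounded forms; this
rests on a minimal representation and on Hahn-Banach in the two factors.  Second, the norms of
forms are compared through their sets of bounds: two forms have the same norm as soon as every
constant bounds one exactly when it bounds the other (\<open>form_norm_eq_if_same_bounds\<close>).  For linearization
this comparison is \<open>bilinear_linear_same_bounds\<close>, which reads a bound off elementary tensors and sums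
it over representations; for completions it is \<open>continuous_extension_bound\<close>, which passes to limits.
Third, these correspondences are compatible with restriction from the whole spaces to the
subspaces, because the elementary tensors of the subspaces are elementary tensors of the whole
spaces, and because the canonical map of the completions keeps representing Cauchy sequences.

The real and the complex field are treated together: a scalar is determined by the real parts of
\<open>z\<close> and \<open>j * z\<close>, where \<open>j\<close> is the imaginary unit or \<open>0\<close>.
\<close>

section \<open>Scalars\<close>

text \<open>
A single normal form for both scalar fields.  The number \<open>j\<close> is the imaginary unit in the complex
case and \<open>0\<close> in the real case, and \<open>re\<close> is the real part; since \<open>re (j * z)\<close> is minus the
imaginary part, a scalar \<open>z\<close> is recovered from the real parts of \<open>z\<close> and \<open>j * z\<close>.  One formula then
turns real-linear functionals into linear forms over either field.
\<close>

lemma real_or_complex_decomposition: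
  obtains re :: "'k::real_or_complex \<Rightarrow> real" and j :: 'k where
    "\<And>z w. re (z + w) = re z + re w" "\<And>r z. re (of_real r * z) = r * re z"
    "\<And>z. \<bar>re z\<bar> \<le> norm z" "re 1 = 1" "re j = 0" "j = 0 \<or> j * j = - 1"
    "\<And>z. z = of_real (re z) - j * of_real (re (j * z))"
proof -
  consider (real) "\<forall>z::'k. \<exists>r. z = r *\<^sub>R 1"
    | (complex) j :: 'k where "j * j = - 1" "\<And>z. \<exists>a b. z = a *\<^sub>R 1 + b *\<^sub>R j"
        "\<And>a b. norm (a *\<^sub>R 1 + b *\<^sub>R j) = sqrt (a\<^sup>2 + b\<^sup>2)"
    using real_or_complex[where 'a = 'k] by blast
  then show thesis
  proof cases
    case real
    define re where "re = (\<lambda>z::'k. THE r. z = of_real r)"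
    have re [simp]: "re (of_real r) = r" for r
      unfolding re_def by (rule the_equality) auto
    have z: "\<exists>r. z = of_real r" for z :: 'k
      using real by (simp add: of_real_def)
    show thesis
    proof (rule that[of re 0])
      fix z w :: 'k and r
      obtain a b where ab: "z = of_real a" "w = of_real b"
        using z by blast
      show "re (z + w) = re z + re w"
        using re[of "a + b"] by (simp add: ab)
      show "re (of_real r * z) = r * re z"
        using re[of "r * a"] by (simp add: ab)
      show "\<bar>re z\<bar> \<le> norm z" by (simp add: ab)
      show "z = of_real (re z) - 0 * of_real (re (0 * z))" by (simp add: ab)
    qed (use re[of 1] re[of 0] in simp_all)
  next
    case complex
    define c where "c a b = a *\<^sub>R (1::'k) + b *\<^sub>R j" for a b
    have n: "norm (c a b) = sqrt (a\<^sup>2 + b\<^sup>2)" for a b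
      unfolding c_def by (rule complex)
    have diff: "c a b - c a' b' = c (a - a') (b - b')" for a b a' b'
      by (simp add: c_def algebra_simps)
    have jj: "j * (j * w) = - w" for w
      using complex(1) by (simp flip: mult.assoc)
    have inj: "a = a' \<and> b = b'" if "c a b = c a' b'" for a b a' b'
      using n[of "a - a'" "b - b'"] that by (simp flip: diff)
    \<comment> \<open>The prescribed absolute value makes \<open>c\<close> injective, so real parts are well defined.\<close>
    define re where "re z = (THE a. \<exists>b. z = c a b)" for z
    have re [simp]: "re (c a b) = a" for a b
      unfolding re_def by (rule the_equality) (use inj in blast)+
    have z: "\<exists>a b. z = c a b" for z
      unfolding c_def by (rule complex)
    show thesis
    proof (rule that[of re j])
      fix z w :: 'k and r
      obtain a b a' b' where ab: "z = c a b" "w = c a' b'"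
        using z by blast
      have "z + w = c (a + a') (b + b')" by (simp add: ab c_def algebra_simps)
      then show "re (z + w) = re z + re w" by (simp add: ab)
      have "of_real r * z = c (r * a) (r * b)" by (simp add: ab c_def scaleR_conv_of_real algebra_simps)
      then show "re (of_real r * z) = r * re z" by (simp add: ab)
      show "\<bar>re z\<bar> \<le> norm z" by (simp add: ab n)
      have "j * z = c (- b) a"
        by (simp add: ab c_def scaleR_conv_of_real algebra_simps jj)
      then show "z = of_real (re z) - j * of_real (re (j * z))"
        by (simp add: ab) (simp add: c_def scaleR_conv_of_real algebra_simps jj)
    next
      show "re 1 = 1" using re[of 1 0] by (simp add: c_def)
      show "re j = 0" using re[of 0 1] by (simp add: c_def)
    qed (use complex in simp)
  qed
qed

text \<open>
The class of normed fields does not include completeness.  It follows here because the two real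
parts in the decomposition above converge separately; it is what allows a bounded form to be
extended from a space to its completion.
\<close>

lemma real_or_complex_complete:
  fixes X :: "nat \<Rightarrow> 'k::real_or_complex"
  assumes "Cauchy X"
  shows "convergent X"
proof -
  obtain re :: "'k \<Rightarrow> real" and j :: 'k where
    re: "\<And>z w. re (z + w) = re z + re w" "\<And>r z. re (of_real r * z) = r * re z"
      "\<And>z. \<bar>re z\<bar> \<le> norm z"
    and z: "\<And>z. z = of_real (re z) - j * of_real (re (j * z))"
    by (rule real_or_complex_decomposition) blast
  have "bounded_linear re"
    by (rule bounded_linear_intro[where K = 1])
      (use re in \<open>auto simp: scaleR_conv_of_real\<close>)
  then have "Cauchy (\<lambda>n. re (X n))" "Cauchy (\<lambda>n. re (j * X n))"
    using bounded_linear.Cauchy[OF _ assms] bounded_linear_compose[OF _ bounded_linear_mult_right]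
    by blast+
  then obtain a b where "(\<lambda>n. re (X n)) \<longlonglongrightarrow> a" "(\<lambda>n. re (j * X n)) \<longlonglongrightarrow> b"
    by (auto simp: Cauchy_convergent_iff convergent_def)
  then have "(\<lambda>n. of_real (re (X n)) - j * of_real (re (j * X n))) \<longlonglongrightarrow> of_real a - j * of_real b"
    by (intro tendsto_intros)
  then show ?thesis
    by (auto simp: convergent_def simp flip: z)
qed

section \<open>The Hahn-Banach theorem over the reals\<close>

text \<open>
The extension is a maximal graph, that is, a linear subset of the product of \<open>V\<close> with the reals
whose second coordinate is dominated by \<open>p\<close> of the first.  Working with graphs turns the order of
extensions into set inclusion, so that unions of chains are upper bounds, and domination alone
makes such a set the graph of a function: a pair \<open>(0, r)\<close> in it satisfies \<open>r \<le> 0\<close>, and also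
\<open>- r \<le> 0\<close>.
\<close>

lemma real_hahn_banach:
  fixes s :: "real \<Rightarrow> 'v::ab_group_add \<Rightarrow> 'v"
  assumes s: "vector_space s" and V: "module.subspace s V" and W: "module.subspace s W" "W \<subseteq> V"
    and p_add: "\<And>x y. x \<in> V \<Longrightarrow> y \<in> V \<Longrightarrow> p (x + y) \<le> p x + p y"
    and p_scale: "\<And>r x. 0 \<le> r \<Longrightarrow> x \<in> V \<Longrightarrow> p (s r x) = r * p x"
    and u_add: "\<And>x y. x \<in> W \<Longrightarrow> y \<in> W \<Longrightarrow> u (x + y) = u x + u y"
    and u_scale: "\<And>r x. x \<in> W \<Longrightarrow> u (s r x) = r * u x"
    and u_le: "\<And>x. x \<in> W \<Longrightarrow> u x \<le> p x"
  obtains U :: "'v \<Rightarrow> real" where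
    "\<And>x y. x \<in> V \<Longrightarrow> y \<in> V \<Longrightarrow> U (x + y) = U x + U y"
    "\<And>r x. x \<in> V \<Longrightarrow> U (s r x) = r * U x"
    "\<And>x. x \<in> V \<Longrightarrow> U x \<le> p x"
    "\<And>x. x \<in> W \<Longrightarrow> U x = u x"
proof -
  interpret vector_space s by fact
  define good where "good G \<longleftrightarrow> (\<lambda>x. (x, u x)) ` W \<subseteq> G \<and>
      (\<forall>(x, r)\<in>G. x \<in> V \<and> r \<le> p x) \<and>
      (\<forall>(x, r)\<in>G. \<forall>(y, t)\<in>G. (x + y, r + t) \<in> G) \<and>
      (\<forall>(x, r)\<in>G. \<forall>c. (s c x, c * r) \<in> G)" for G
  have "\<exists>G\<in>Collect good. \<forall>H\<in>Collect good. G \<subseteq> H \<longrightarrow> H = G"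
  proof (rule subset_Zorn_nonempty)
    have "good ((\<lambda>x. (x, u x)) ` W)"
      using W u_add u_scale u_le subspace_add[OF W(1)] subspace_scale[OF W(1)]
      by (auto simp: good_def image_iff)
    then show "Collect good \<noteq> {}" by blast
    fix \<C> assume \<C>: "\<C> \<noteq> {}" "subset.chain (Collect good) \<C>"
    then have good: "good G" if "G \<in> \<C>" for G
      using that by (auto simp: subset_chain_def)
    have *: "\<exists>G\<in>\<C>. a \<in> G \<and> b \<in> G" if "a \<in> \<Union>\<C>" "b \<in> \<Union>\<C>" for a b
      using that \<C>(2) unfolding subset_chain_def by blast
    have add: "(x + y, r + t) \<in> \<Union>\<C>" if "(x, r) \<in> \<Union>\<C>" "(y, t) \<in> \<Union>\<C>" for x r y t
      using *[OF that] good unfolding good_def by fast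
    have scale: "(s c x, c * r) \<in> \<Union>\<C>" and le: "x \<in> V \<and> r \<le> p x"
      if "(x, r) \<in> \<Union>\<C>" for x r c
      using that good unfolding good_def by fast+
    have "(\<lambda>x. (x, u x)) ` W \<subseteq> \<Union>\<C>"
      using \<C>(1) good unfolding good_def by fast
    then have "good (\<Union>\<C>)"
      unfolding good_def Ball_def split_paired_All prod.case
      by (intro conjI allI impI add scale conjunct1[OF le] conjunct2[OF le]) assumption+
    then show "\<Union>\<C> \<in> Collect good" by blast
  qed
  then obtain G where "good G" and max: "\<And>H. good H \<Longrightarrow> G \<subseteq> H \<Longrightarrow> H = G"
    by auto
  then have GW: "x \<in> W \<Longrightarrow> (x, u x) \<in> G"
    and GVp: "(x, r) \<in> G \<Longrightarrow> x \<in> V \<and> r \<le> p x"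
    and G_add: "(x, r) \<in> G \<Longrightarrow> (y, t) \<in> G \<Longrightarrow> (x + y, r + t) \<in> G"
    and G_scale: "(x, r) \<in> G \<Longrightarrow> (s c x, c * r) \<in> G" for x y r t c
    unfolding good_def Ball_def split_paired_All prod.case image_subset_iff by simp_all
  note GV = conjunct1[OF GVp] and Gp = conjunct2[OF GVp]
  have G0: "(0, 0) \<in> G"
    using GW[of 0] subspace_0[OF W(1)] u_scale[of 0 0] by simp
  have total: "\<exists>a. (v, a) \<in> G" if v: "v \<in> V" for v
  proof -
    let ?S = "{r - p (x - v) | x r. (x, r) \<in> G}"
    have le: "r - p (x - v) \<le> p (y + v) - t" if "(x, r) \<in> G" "(y, t) \<in> G" for x r y t
    proof -
      have "r + t \<le> p (x + y)" using Gp[OF G_add] that by blast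
      also have "\<dots> = p ((x - v) + (y + v))" by simp
      also have "\<dots> \<le> p (x - v) + p (y + v)"
        using GV that v by (intro p_add subspace_add[OF V] subspace_diff[OF V]) auto
      finally show ?thesis by simp
    qed
    \<comment> \<open>A value \<open>a\<close> at \<open>v\<close> is admissible when it lies between the two families separated by \<open>le\<close>.\<close>
    define a where "a = Sup ?S"
    have bdd: "bdd_above ?S"
      using le[OF _ G0] by (auto intro!: bdd_aboveI)
    have lower: "r - a \<le> p (x - v)" if "(x, r) \<in> G" for x r
      using cSup_upper[OF _ bdd, of "r - p (x - v)"] that unfolding a_def by force
    have upper: "t + a \<le> p (y + v)" if "(y, t) \<in> G" for y t
      using cSup_least[of ?S "p (y + v) - t"] le[OF _ that] G0 unfolding a_def by force
    have bound: "r + c * a \<le> p (x + s c v)" if "(x, r) \<in> G" for x r c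
    \<comment> \<open>Dividing by \<open>\<bar>c\<bar>\<close> reduces every coefficient of \<open>v\<close> to \<open>1\<close> or \<open>- 1\<close>.\<close>
    proof (cases c "0::real" rule: linorder_cases)
      case equal
      then show ?thesis using Gp[OF that] by simp
    next
      case greater
      have "r + c * a = c * (inverse c * r + a)" using greater by (simp add: field_simps)
      also have "\<dots> \<le> c * p (s (inverse c) x + v)"
        using upper[OF G_scale[OF that]] greater by simp
      also have "\<dots> = p (s c (s (inverse c) x + v))"
        using greater GV[OF G_scale[OF that]] v by (simp add: p_scale subspace_add[OF V])
      finally show ?thesis using greater by (simp add: scale_right_distrib)
    next
      case less
      have "r + c * a = - c * (inverse (- c) * r - a)" using less by (simp add: field_simps)
      also have "\<dots> \<le> - c * p (s (inverse (- c)) x - v)"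
        using less by (intro mult_left_mono lower[OF G_scale[OF that]]) auto
      also have "\<dots> = p (s (- c) (s (inverse (- c)) x - v))"
        using less by (intro p_scale[symmetric] subspace_diff[OF V] GV[OF G_scale[OF that]] v) auto
      finally show ?thesis using less by (simp add: scale_right_diff_distrib)
    qed
    define H where "H = {(x + s c v, r + c * a) | x r c. (x, r) \<in> G}"
    have H: "(x + s c v, r + c * a) \<in> H" if "(x, r) \<in> G" for x r c
      using that unfolding H_def by blast
    have HI: "(y, t) \<in> H" if "(x, r) \<in> G" "y = x + s c v" "t = r + c * a" for y t x r c
      using H that by blast
    have HE: "\<exists>x r c. (x, r) \<in> G \<and> y = x + s c v \<and> t = r + c * a" if "(y, t) \<in> H" for y t
      using that unfolding H_def by blast
    have "G \<subseteq> H"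
    proof clarify
      fix x r assume "(x, r) \<in> G"
      then show "(x, r) \<in> H" by (rule HI[of _ _ _ 0]) auto
    qed
    moreover have "good H"
      unfolding good_def Ball_def split_paired_All prod.case image_subset_iff
    proof (intro conjI allI impI)
      show "(x, u x) \<in> H" if "x \<in> W" for x
        using GW[OF that] \<open>G \<subseteq> H\<close> by blast
      show "x \<in> V" "r \<le> p x" if "(x, r) \<in> H" for x r
        using HE[OF that] bound GV subspace_add[OF V] subspace_scale[OF V v] by auto
      show "(x + y, r + t) \<in> H" if H2: "(x, r) \<in> H" "(y, t) \<in> H" for x r y t
      proof -
        obtain x' r' c y' t' d where
          *: "(x', r') \<in> G" "x = x' + s c v" "r = r' + c * a"
             "(y', t') \<in> G" "y = y' + s d v" "t = t' + d * a"
          using HE[OF H2(1)] HE[OF H2(2)] by blast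
        show ?thesis
          by (rule HI[OF G_add[OF *(1,4)], of _ "c + d"]) (simp_all add: * algebra_simps)
      qed
      show "(s d x, d * r) \<in> H" if Hx: "(x, r) \<in> H" for x r d
      proof -
        obtain x' r' c where *: "(x', r') \<in> G" "x = x' + s c v" "r = r' + c * a"
          using HE[OF Hx] by blast
        show ?thesis
          by (rule HI[OF G_scale[OF *(1)], of _ d "d * c"]) (simp_all add: * algebra_simps)
      qed
    qed
    ultimately have "H = G" by (rule max[rotated])
    moreover have "(v, a) \<in> H"
      by (rule HI[OF G0, of _ 1]) auto
    ultimately show ?thesis by blast
  qed
  have unique: "r = t" if "(x, r) \<in> G" "(x, t) \<in> G" for x r t
  proof -
    have "r - t \<le> 0" if "(x, r) \<in> G" "(x, t) \<in> G" for r t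
      using Gp[OF G_add[OF that(1) G_scale[OF that(2), of "- 1"]]] p_scale[of 0 0] subspace_0[OF V]
      by simp
    from this[OF that] this[OF that(2,1)] show ?thesis by simp
  qed
  define U where "U x = (THE r. (x, r) \<in> G)" for x
  have U: "U x = r" if "(x, r) \<in> G" for x r
    unfolding U_def using that unique by blast
  have GU: "(x, U x) \<in> G" if "x \<in> V" for x
    using total[OF that] U by blast
  show thesis
  proof
    show "U (x + y) = U x + U y" if "x \<in> V" "y \<in> V" for x y
      using that by (intro U G_add GU)
    show "U (s r x) = r * U x" if "x \<in> V" for x r
      using that by (intro U G_scale GU)
    show "U x \<le> p x" if "x \<in> V" for x
      by (intro Gp GU that)
    show "U x = u x" if "x \<in> W" for x
      by (intro U GW that)
  qed
qed

section \<open>Bounds and norms of linear forms\<close>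

text \<open>
The norm of a form is defined as a supremum of quotients.  The proofs use instead the set of all
\<open>C\<close> with \<open>norm (f v) \<le> C * vnorm E v\<close> throughout \<open>E\<close>: it is the set of upper bounds of the
quotients, so it determines boundedness and the norm, and it is stable under limits and under
infima over representations.
\<close>

definition form_bound :: "('k::real_normed_field, 'v) nspace \<Rightarrow> ('v \<Rightarrow> 'k) \<Rightarrow> real \<Rightarrow> bool" where
  "form_bound E f C \<longleftrightarrow> (\<forall>v\<in>points E. norm (f v) \<le> C * vnorm E v)"

text \<open>
The part of the norm axioms that makes quotients and bounds equivalent.  It is formulated for
the explicit operations because it is applied to completions too, whose operations are not those
of a type class.
\<close>

definition definite_nspace :: "('k::real_normed_field, 'v) nspace \<Rightarrow> bool" where
  "definite_nspace E \<longleftrightarrow> vzero E \<in> points E \<and> vadd E (vzero E) (vzero E) = vzero E \<and>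
     vnorm E (vzero E) = 0 \<and> (\<forall>v\<in>points E - {vzero E}. 0 < vnorm E v)"

lemma linear_form_zero:
  assumes "definite_nspace E" "linear_form_on E f"
  shows "f (vzero E) = 0"
proof -
  have "f (vzero E) = f (vzero E) + f (vzero E)"
    using assms unfolding definite_nspace_def linear_form_on_def by metis
  then show ?thesis by simp
qed

lemma form_bound_iff_quotients:
  assumes "definite_nspace E" "linear_form_on E f"
  shows "form_bound E f C \<longleftrightarrow> (\<forall>q\<in>form_quotients E f. q \<le> C)"
proof -
  have "(\<forall>q\<in>form_quotients E f. q \<le> C) \<longleftrightarrow>
      (\<forall>v\<in>points E - {vzero E}. norm (f v) / vnorm E v \<le> C)"
    by (auto simp: form_quotients_def)
  also have "\<dots> \<longleftrightarrow> (\<forall>v\<in>points E - {vzero E}. norm (f v) \<le> C * vnorm E v)"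
    using assms(1) unfolding definite_nspace_def
    by (intro ball_cong refl) (simp add: pos_divide_le_eq)
  also have "\<dots> \<longleftrightarrow> form_bound E f C"
    using assms(1) linear_form_zero[OF assms] unfolding form_bound_def definite_nspace_def
    by (metis Diff_iff mult_zero_right norm_zero order_refl singletonD)
  finally show ?thesis by simp
qed

lemma bounded_linear_form_on_iff:
  assumes "definite_nspace E"
  shows "bounded_linear_form_on E f \<longleftrightarrow> linear_form_on E f \<and> (\<exists>C. form_bound E f C)"
  unfolding bounded_linear_form_on_def bdd_above_def
  using form_bound_iff_quotients[OF assms] by blast

lemma form_bound_form_norm:
  assumes "definite_nspace E" "bounded_linear_form_on E f"
  shows "form_bound E f (form_norm E f)"
  using assms form_bound_iff_quotients[OF assms(1)]
  by (auto simp: bounded_linear_form_on_def form_norm_def intro!: cSup_upper)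

lemma form_norm_le:
  assumes "definite_nspace E" "points E \<noteq> {vzero E}" "linear_form_on E f" "form_bound E f C"
  shows "form_norm E f \<le> C"
proof -
  have "points E - {vzero E} \<noteq> {}"
    using assms(1,2) unfolding definite_nspace_def by blast
  then have "form_quotients E f \<noteq> {}"
    by (auto simp: form_quotients_def)
  then show ?thesis
    using assms form_bound_iff_quotients[OF assms(1,3)] unfolding form_norm_def
    by (auto intro!: cSup_least)
qed

lemma form_norm_nonneg:
  assumes "definite_nspace E" "points E \<noteq> {vzero E}" "bounded_linear_form_on E f"
  shows "0 \<le> form_norm E f"
proof -
  obtain v where v: "v \<in> points E" "0 < vnorm E v"
    using assms(1,2) unfolding definite_nspace_def by blast
  then have "0 \<le> form_norm E f * vnorm E v"
    using form_bound_form_norm[OF assms(1,3)] unfolding form_bound_def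
    by (meson norm_ge_zero order_trans)
  then show ?thesis using v by (simp add: zero_le_mult_iff)
qed

text \<open>
On the reals \<open>Sup\<close> is the least upper bound chosen by \<open>LEAST\<close>, hence a function of the set of
upper bounds alone, even for sets that are empty or unbounded.
\<close>

lemma Sup_eq_if_same_upper_bounds:
  fixes S T :: "real set"
  assumes "\<And>C. (\<forall>q\<in>S. q \<le> C) \<longleftrightarrow> (\<forall>q\<in>T. q \<le> C)"
  shows "Sup S = Sup T"
  using assms by (simp add: Sup_real_def)

lemma form_norm_eq_if_same_bounds:
  assumes "definite_nspace E" "linear_form_on E f" "definite_nspace E'" "linear_form_on E' f'"
    and "\<And>C. form_bound E f C \<longleftrightarrow> form_bound E' f' C"
  shows "form_norm E f = form_norm E' f'"
  unfolding form_norm_def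
  by (rule Sup_eq_if_same_upper_bounds)
    (use assms in \<open>simp flip: form_bound_iff_quotients\<close>)

section \<open>Separation by bounded forms\<close>

text \<open>
A linear manifold \<open>V\<close> of a vector space with a norm \<open>p\<close> that is only required to behave on \<open>V\<close>.
This form covers the given normed spaces and the projective tensor products alike; the
projective norm has no meaning outside the tensors.
\<close>

locale normed_manifold = vector_space scale
  for scale :: "'k::real_or_complex \<Rightarrow> 'v::ab_group_add \<Rightarrow> 'v" +
  fixes V :: "'v set" and p :: "'v \<Rightarrow> real"
  assumes subspace_V: "subspace V"
    and triangle: "x \<in> V \<Longrightarrow> y \<in> V \<Longrightarrow> p (x + y) \<le> p x + p y"
    and norm_scale: "x \<in> V \<Longrightarrow> p (scale c x) = norm c * p x"
    and definite: "x \<in> V \<Longrightarrow> p x = 0 \<Longrightarrow> x = 0"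
begin

definition nspace :: "('k, 'v) nspace" where
  "nspace = \<lparr>points = V, vadd = (+), vzero = 0, vscale = scale, vnorm = p\<rparr>"

lemma nspace_simps [simp]:
  "points nspace = V" "vadd nspace = (+)" "vzero nspace = 0" "vscale nspace = scale"
  "vnorm nspace = p"
  by (simp_all add: nspace_def)

lemma norm_zero' [simp]: "p 0 = 0"
  using norm_scale[of 0 0] subspace_0[OF subspace_V] by simp

lemma norm_minus: "x \<in> V \<Longrightarrow> p (- x) = p x"
  using norm_scale[of x "- 1"] by simp

lemma norm_nonneg: "x \<in> V \<Longrightarrow> 0 \<le> p x"
  using triangle[of x "- x"] norm_minus[of x] subspace_neg[OF subspace_V] by simp

lemma definite_nspace: "definite_nspace nspace"
  using subspace_0[OF subspace_V] definite norm_nonneg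
  by (force simp: definite_nspace_def less_le)

lemma linear_form_iff:
  "linear_form_on nspace f \<longleftrightarrow>
     (\<forall>u\<in>V. \<forall>v\<in>V. f (u + v) = f u + f v) \<and> (\<forall>c. \<forall>v\<in>V. f (scale c v) = c * f v)"
  by (simp add: linear_form_on_def)

lemma form_bound_iff: "form_bound nspace f C \<longleftrightarrow> (\<forall>v\<in>V. norm (f v) \<le> C * p v)"
  by (simp add: form_bound_def)

text \<open>
The real part of \<open>f\<close> is extended by the real theorem to a functional \<open>U\<close>, and \<open>U\<close> is the real part
of the linear form \<open>g x = U x - j * U (j x)\<close>.  The bound survives because \<open>g x\<close> can be rotated
onto the nonnegative real axis by a scalar of absolute value \<open>1\<close>, where it coincides with \<open>U\<close>.
\<close>

theorem hahn_banach:
  assumes W: "subspace W" "W \<subseteq> V" and C: "0 \<le> C"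
    and f_add: "\<And>x y. x \<in> W \<Longrightarrow> y \<in> W \<Longrightarrow> f (x + y) = f x + f y"
    and f_scale: "\<And>c x. x \<in> W \<Longrightarrow> f (scale c x) = c * f x"
    and f_bound: "\<And>x. x \<in> W \<Longrightarrow> norm (f x) \<le> C * p x"
  obtains g where "linear_form_on nspace g" "form_bound nspace g C" "\<And>x. x \<in> W \<Longrightarrow> g x = f x"
proof -
  obtain re :: "'k \<Rightarrow> real" and j :: 'k where
    re_add: "\<And>z w. re (z + w) = re z + re w" and re_scale: "\<And>r z. re (of_real r * z) = r * re z"
    and re_le: "\<And>z. \<bar>re z\<bar> \<le> norm z" and re_1: "re 1 = 1" and re_j: "re j = 0"
    and j: "j = 0 \<or> j * j = - 1"
    and decomp: "\<And>z. z = of_real (re z) - j * of_real (re (j * z))"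
    by (rule real_or_complex_decomposition) blast
  define s where "s r x = scale (of_real r) x" for r x
  have s: "vector_space s"
    by standard (auto simp: s_def scale_right_distrib scale_left_distrib)
  then have module_s: "module s" by (simp add: module_iff_vector_space)
  have subspace_s: "module.subspace s U" if "subspace U" for U
    using that by (simp add: subspace_def module.subspace_def[OF module_s] s_def)
  obtain U where
    U_add: "\<And>x y. x \<in> V \<Longrightarrow> y \<in> V \<Longrightarrow> U (x + y) = U x + U y"
    and U_scale: "\<And>r x. x \<in> V \<Longrightarrow> U (s r x) = r * U x"
    and U_le: "\<And>x. x \<in> V \<Longrightarrow> U x \<le> C * p x"
    and U_f: "\<And>x. x \<in> W \<Longrightarrow> U x = re (f x)"
  proof (rule real_hahn_banach[OF s subspace_s[OF subspace_V] subspace_s[OF W(1)] W(2),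
        of "\<lambda>x. C * p x" "\<lambda>x. re (f x)"])
    show "C * p (x + y) \<le> C * p x + C * p y" if "x \<in> V" "y \<in> V" for x y
      using mult_left_mono[OF triangle[OF that] C] by (simp add: distrib_left)
    show "C * p (s r x) = r * (C * p x)" if "0 \<le> r" "x \<in> V" for r x
      using that by (simp add: s_def norm_scale)
    show "re (f (x + y)) = re (f x) + re (f y)" if "x \<in> W" "y \<in> W" for x y
      using that by (simp add: f_add re_add)
    show "re (f (s r x)) = r * re (f x)" if "x \<in> W" for r x
      using that by (simp add: s_def f_scale re_scale)
    show "re (f x) \<le> C * p x" if "x \<in> W" for x
      using f_bound[OF that] re_le[of "f x"] by simp
  qed blast
  define g where "g x = of_real (U x) - j * of_real (U (scale j x))" for x
  have jV: "scale c x \<in> V" if "x \<in> V" for c x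
    using that by (rule subspace_scale[OF subspace_V])
  have g_add: "g (x + y) = g x + g y" if "x \<in> V" "y \<in> V" for x y
    using that by (simp add: g_def scale_right_distrib U_add jV algebra_simps)
  have g_real: "g (scale (of_real r) x) = of_real r * g x" if "x \<in> V" for r x
  proof -
    have "scale j (s r x) = s r (scale j x)" by (simp add: s_def mult.commute)
    then show ?thesis
      using that by (simp add: g_def U_scale jV algebra_simps flip: s_def)
  qed
  have g_j: "g (scale j x) = j * g x" if "x \<in> V" for x
  proof -
    have "U 0 = 0" using U_scale[of 0 0] subspace_0[OF subspace_V] by (simp add: s_def)
    moreover have "U (scale (- 1) x) = - U x" using U_scale[OF that, of "- 1"] by (simp add: s_def)
    ultimately show ?thesis
      using j by (auto simp: g_def right_diff_distrib mult.assoc[symmetric])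
  qed
  have g_scale: "g (scale c x) = c * g x" if x: "x \<in> V" for c x
  proof -
    define a b where "a = re c" and "b = - re (j * c)"
    have c: "c = of_real a + of_real b * j"
      using decomp[of c] by (simp add: a_def b_def mult.commute)
    have "scale c x = scale (of_real a) x + scale (of_real b) (scale j x)"
      by (simp add: c scale_left_distrib)
    then have "g (scale c x) = of_real a * g x + of_real b * (j * g x)"
      using x by (simp add: g_add g_real g_j jV del: scale_scale)
    then show ?thesis by (simp add: c algebra_simps)
  qed
  have re_g: "re (g x) = U x" for x
  proof -
    have "re (g x) + re (of_real (U (scale j x)) * j) = re (of_real (U x) * 1)"
      by (simp add: g_def mult.commute flip: re_add)
    then show ?thesis by (simp only: re_scale re_j re_1)
  qed
  show thesis
  proof
    show "linear_form_on nspace g"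
      using g_add g_scale by (simp add: linear_form_iff)
    show "g x = f x" if "x \<in> W" for x
      using that W(1) decomp[of "f x"] by (simp add: g_def U_f subspace_scale f_scale)
    show "form_bound nspace g C"
      unfolding form_bound_iff
    proof
      fix x assume x: "x \<in> V"
      show "norm (g x) \<le> C * p x"
      proof (cases "g x = 0")
        case True
        then show ?thesis using C norm_nonneg[OF x] by simp
      next
        case False
        \<comment> \<open>The rotation that makes \<open>c * g x\<close> real and nonnegative.\<close>
        define c where "c = of_real (norm (g x)) / g x"
        have "norm c = 1" using False by (simp add: c_def norm_divide)
        have "norm (g x) = re (of_real (norm (g x)) * 1)" unfolding re_scale re_1 by simp
        also have "of_real (norm (g x)) * 1 = g (scale c x)"
          using False x by (simp add: g_scale c_def)
        also have "re \<dots> \<le> C * p (scale c x)"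
          using U_le jV[OF x] by (simp add: re_g)
        also have "\<dots> = C * p x" using x \<open>norm c = 1\<close> by (simp add: norm_scale)
        finally show ?thesis .
      qed
    qed
  qed
qed

lemma norming_form:
  assumes v: "v \<in> V" "v \<noteq> 0"
  obtains g where "linear_form_on nspace g" "form_bound nspace g 1" "g v = of_real (p v)"
proof -
  define f where "f x = (THE c. x = scale c v) * of_real (p v)" for x
  have f: "f (scale c v) = c * of_real (p v)" for c
    using v by (simp add: f_def)
  have W: "span {v} = range (\<lambda>c. scale c v)" by (rule span_singleton)
  show thesis
  proof (rule hahn_banach[of "span {v}" 1 f])
    show "span {v} \<subseteq> V"
      using v by (intro span_minimal subspace_V) simp
    show "f (x + y) = f x + f y" if "x \<in> span {v}" "y \<in> span {v}" for x y
      using that unfolding W by (auto simp: f distrib_right simp flip: scale_left_distrib)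
    show "f (scale c x) = c * f x" if "x \<in> span {v}" for c x
      using that unfolding W by (auto simp: f simp del: scale_scale simp add: scale_scale)
    show "norm (f x) \<le> 1 * p x" if "x \<in> span {v}" for x
      using that v unfolding W by (auto simp: f norm_mult norm_scale norm_nonneg)
    fix g assume g: "linear_form_on nspace g" "form_bound nspace g 1"
      "\<And>x. x \<in> span {v} \<Longrightarrow> g x = f x"
    have "g v = of_real (p v)"
      using g(3)[of v] f[of 1] by (simp add: span_base)
    with g(1,2) show thesis by (rule that)
  qed (use subspace_span in auto)
qed

end

context normed_manifold
begin

lemma in_V: "x \<in> V \<Longrightarrow> y \<in> V \<Longrightarrow> x + y \<in> V" "x \<in> V \<Longrightarrow> y \<in> V \<Longrightarrow> x - y \<in> V"
    "x \<in> V \<Longrightarrow> scale c x \<in> V" "0 \<in> V"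
  using subspace_V by (simp_all add: subspace_add subspace_diff subspace_scale subspace_0)

text \<open>
Finite-dimensional subspaces can be separated from outside points by bounded forms.  The
induction only needs that bounded forms separate points: if \<open>g\<close> annihilates \<open>xs\<close> but not \<open>w\<close>, then
moving \<open>v\<close> along \<open>w\<close> into the kernel of \<open>g\<close> and correcting the form found for the moved point by a
multiple of \<open>g\<close> produces a form that annihilates \<open>w\<close> as well.
\<close>

lemma annihilating_form:
  assumes "set xs \<subseteq> V" "v \<in> V" "v \<notin> span (set xs)"
  obtains f where "bounded_linear_form_on nspace f" "\<And>x. x \<in> set xs \<Longrightarrow> f x = 0" "f v \<noteq> 0"
  using assms
proof (induction xs arbitrary: v thesis)
  case Nil
  have "v \<noteq> 0" using Nil by simp
  then obtain g where g: "linear_form_on nspace g" "form_bound nspace g 1" "g v = of_real (p v)"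
    using norming_form Nil by metis
  moreover have "p v \<noteq> 0" using definite \<open>v \<noteq> 0\<close> Nil by blast
  ultimately show ?case
    using definite_nspace by (intro Nil(1)[of g]) (auto simp: bounded_linear_form_on_iff)
next
  case (Cons w xs)
  show ?case
  proof (cases "w \<in> span (set xs)")
    case True
    then have "v \<notin> span (set xs)"
      using Cons.prems(4) by (simp add: span_redundant)
    then obtain f where f: "bounded_linear_form_on nspace f" "\<And>x. x \<in> set xs \<Longrightarrow> f x = 0" "f v \<noteq> 0"
      using Cons.IH Cons.prems by (metis set_subset_Cons subset_trans)
    have lin: "linear_form_on nspace f" using f(1) by (simp add: bounded_linear_form_on_def)
    have "w \<in> V \<and> f w = 0"
      using True
    proof (induction rule: span_induct_alt)
      case base
      show ?case using linear_form_zero[OF definite_nspace lin] by (simp add: in_V)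
    next
      case (step c x y)
      then have "x \<in> V" "f x = 0" using Cons.prems(2) f(2) by auto
      then show ?case using step lin by (simp add: linear_form_iff in_V)
    qed
    then show ?thesis using f by (intro Cons.prems(1)[of f]) auto
  next
    case False
    obtain g where g: "bounded_linear_form_on nspace g" "\<And>x. x \<in> set xs \<Longrightarrow> g x = 0" "g w \<noteq> 0"
      using Cons.IH[OF _ _ _ False] Cons.prems by (metis list.set_intros(1) set_subset_Cons subset_trans subsetD)
    define v' where "v' = v - scale (g v / g w) w"
    have "v' \<notin> span (set xs)"
      using Cons.prems(4) span_breakdown_eq[of v w "set xs"] by (auto simp: v'_def)
    moreover have "v' \<in> V"
      using Cons.prems by (simp add: v'_def subspace_V subspace_diff subspace_scale)
    ultimately obtain f where f: "bounded_linear_form_on nspace f" "\<And>x. x \<in> set xs \<Longrightarrow> f x = 0" "f v' \<noteq> 0"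
      using Cons.IH Cons.prems by (metis set_subset_Cons subset_trans)
    define h where "h x = f x - f w / g w * g x" for x
    obtain C D where lin: "linear_form_on nspace f" "linear_form_on nspace g"
      and bound: "form_bound nspace f C" "form_bound nspace g D"
      using f(1) g(1) definite_nspace by (auto simp: bounded_linear_form_on_iff)
    show ?thesis
    proof (rule Cons.prems(1)[of h])
      have "linear_form_on nspace h"
        using lin by (simp add: linear_form_iff h_def algebra_simps add_divide_distrib)
      moreover have "form_bound nspace h (C + norm (f w / g w) * D)"
        unfolding form_bound_iff
      proof
        fix x assume "x \<in> V"
        have "norm (h x) \<le> norm (f x) + norm (f w / g w) * norm (g x)"
          unfolding h_def norm_mult[symmetric] by (rule norm_triangle_ineq4)
        also have "\<dots> \<le> C * p x + norm (f w / g w) * (D * p x)"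
          using bound \<open>x \<in> V\<close> unfolding form_bound_iff by (intro add_mono mult_left_mono) auto
        finally show "norm (h x) \<le> (C + norm (f w / g w) * D) * p x"
          by (simp add: algebra_simps)
      qed
      ultimately show "bounded_linear_form_on nspace h"
        using definite_nspace by (auto simp: bounded_linear_form_on_iff)
      show "h x = 0" if "x \<in> set (w # xs)" for x
        using that f g by (auto simp: h_def)
      have "w \<in> V" using Cons.prems by simp
      then have "f (v + scale (- (g v / g w)) w) = f v + - (g v / g w) * f w"
        using lin(1) Cons.prems(3) in_V(3) unfolding linear_form_iff by metis
      then have "f v' = f v - g v / g w * f w"
        by (simp add: v'_def)
      then show "h v \<noteq> 0" using f(3) by (simp add: h_def mult.commute)
    qed
  qed
qed

section \<open>Bounded forms on a completion\<close>

abbreviation "completed \<equiv> nspace_completion nspace"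
abbreviation "class_of s \<equiv> cauchy_rel nspace `` {s}"

lemma vdist_eq [simp]: "vdist nspace u v = p (u - v)"
  by (simp add: vdist_def)

lemma cauchy_seqs_iff:
  "s \<in> cauchy_seqs nspace \<longleftrightarrow>
     (\<forall>n. s n \<in> V) \<and> (\<forall>e>0. \<exists>n0. \<forall>m\<ge>n0. \<forall>n\<ge>n0. p (s m - s n) < e)"
  by (auto simp: cauchy_seqs_def)

lemma cauchy_seqs_in: "s \<in> cauchy_seqs nspace \<Longrightarrow> s n \<in> V"
  by (simp add: cauchy_seqs_iff)

lemma cauchy_seqs_const: "v \<in> V \<Longrightarrow> (\<lambda>_. v) \<in> cauchy_seqs nspace"
  by (simp add: cauchy_seqs_iff)

lemma norm_diff_add: "x \<in> V \<Longrightarrow> x' \<in> V \<Longrightarrow> y \<in> V \<Longrightarrow> y' \<in> V \<Longrightarrow>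
    p ((x + y) - (x' + y')) \<le> p (x - x') + p (y - y')"
  using triangle[of "x - x'" "y - y'"] by (simp add: in_V algebra_simps)

lemma norm_diff_commute: "x \<in> V \<Longrightarrow> y \<in> V \<Longrightarrow> p (x - y) = p (y - x)"
  using norm_minus[of "y - x"] by (simp add: in_V)

lemma norm_diff_triangle: "x \<in> V \<Longrightarrow> y \<in> V \<Longrightarrow> z \<in> V \<Longrightarrow> p (x - z) \<le> p (x - y) + p (y - z)"
  using triangle[of "x - y" "y - z"] by (simp add: in_V)

lemma cauchy_seqs_add:
  assumes "s \<in> cauchy_seqs nspace" "t \<in> cauchy_seqs nspace"
  shows "(\<lambda>n. s n + t n) \<in> cauchy_seqs nspace"
  unfolding cauchy_seqs_iff
proof (intro conjI allI impI)
  fix e :: real assume "0 < e"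
  then obtain n1 n2 where "\<forall>m\<ge>n1. \<forall>n\<ge>n1. p (s m - s n) < e / 2" "\<forall>m\<ge>n2. \<forall>n\<ge>n2. p (t m - t n) < e / 2"
    using assms by (meson cauchy_seqs_iff half_gt_zero)
  then have "p (s m + t m - (s n + t n)) < e" if "m \<ge> max n1 n2" "n \<ge> max n1 n2" for m n
    using norm_diff_add[of "s m" "s n" "t m" "t n"] assms that
    by (simp add: cauchy_seqs_in) (smt (verit) field_sum_of_halves)
  then show "\<exists>n0. \<forall>m\<ge>n0. \<forall>n\<ge>n0. p (s m + t m - (s n + t n)) < e" by blast
qed (use assms in \<open>simp add: cauchy_seqs_in in_V\<close>)

lemma cauchy_seqs_scale:
  assumes "s \<in> cauchy_seqs nspace"
  shows "(\<lambda>n. scale c (s n)) \<in> cauchy_seqs nspace"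
  unfolding cauchy_seqs_iff
proof (intro conjI allI impI)
  fix e :: real assume "0 < e"
  then have "0 < e / (norm c + 1)" by (simp add: add_nonneg_pos)
  then obtain n0 where n0: "\<forall>m\<ge>n0. \<forall>n\<ge>n0. p (s m - s n) < e / (norm c + 1)"
    using assms by (meson cauchy_seqs_iff)
  have "p (scale c (s m) - scale c (s n)) < e" if "m \<ge> n0" "n \<ge> n0" for m n
  proof -
    have "p (scale c (s m) - scale c (s n)) = norm c * p (s m - s n)"
      using assms by (simp add: norm_scale in_V cauchy_seqs_in flip: scale_right_diff_distrib)
    also have "\<dots> \<le> (norm c + 1) * p (s m - s n)"
      using assms by (intro mult_right_mono norm_nonneg in_V) (auto simp: cauchy_seqs_in)
    also have "\<dots> < e"
      using n0 that by (simp add: pos_less_divide_eq add_nonneg_pos mult.commute)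
    finally show ?thesis .
  qed
  then show "\<exists>n0. \<forall>m\<ge>n0. \<forall>n\<ge>n0. p (scale c (s m) - scale c (s n)) < e" by blast
qed (use assms in \<open>simp add: cauchy_seqs_in in_V\<close>)

lemma cauchy_rel_iff:
  "(s, t) \<in> cauchy_rel nspace \<longleftrightarrow> s \<in> cauchy_seqs nspace \<and> t \<in> cauchy_seqs nspace \<and>
     (\<lambda>n. p (s n - t n)) \<longlonglongrightarrow> 0"
  by (simp add: cauchy_rel_def)

lemma tendsto_zero_dominated:
  assumes "b \<longlonglongrightarrow> (0::real)" "\<And>n. 0 \<le> a n" "\<And>n. a n \<le> b n"
  shows "a \<longlonglongrightarrow> 0"
  by (rule tendsto_sandwich[OF _ _ tendsto_const assms(1)]) (use assms in auto)

lemma equiv_cauchy_rel: "equiv (cauchy_seqs nspace) (cauchy_rel nspace)"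
proof (rule equivI)
  show "cauchy_rel nspace \<subseteq> cauchy_seqs nspace \<times> cauchy_seqs nspace"
    by (auto simp: cauchy_rel_iff)
  show "refl_on (cauchy_seqs nspace) (cauchy_rel nspace)"
    by (auto simp: refl_on_def cauchy_rel_iff)
  show "sym (cauchy_rel nspace)"
    by (rule symI) (simp add: cauchy_rel_iff norm_diff_commute cauchy_seqs_in)
  show "trans (cauchy_rel nspace)"
  proof (rule transI)
    fix s t w assume *: "(s, t) \<in> cauchy_rel nspace" "(t, w) \<in> cauchy_rel nspace"
    then have V: "s n \<in> V" "t n \<in> V" "w n \<in> V" for n
      by (simp_all add: cauchy_rel_iff cauchy_seqs_in)
    from * have "(\<lambda>n. p (s n - t n) + p (t n - w n)) \<longlonglongrightarrow> 0"
      unfolding cauchy_rel_iff by (intro tendsto_add_zero) auto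
    then have "(\<lambda>n. p (s n - w n)) \<longlonglongrightarrow> 0"
      by (rule tendsto_zero_dominated) (intro norm_nonneg norm_diff_triangle in_V V)+
    then show "(s, w) \<in> cauchy_rel nspace" using * by (simp add: cauchy_rel_iff)
  qed
qed

lemma class_eq_iff:
  assumes "s \<in> cauchy_seqs nspace" "t \<in> cauchy_seqs nspace"
  shows "class_of s = class_of t \<longleftrightarrow> (\<lambda>n. p (s n - t n)) \<longlonglongrightarrow> 0"
  using eq_equiv_class_iff[OF equiv_cauchy_rel assms] assms by (simp add: cauchy_rel_iff)

lemma class_self: "s \<in> cauchy_seqs nspace \<Longrightarrow> s \<in> class_of s"
  by (rule equiv_class_self[OF equiv_cauchy_rel])

lemma points_completion: "P \<in> points completed \<longleftrightarrow> (\<exists>s\<in>cauchy_seqs nspace. P = class_of s)"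
  by (auto simp: nspace_completion_def quotient_def)

lemma vzero_completion: "vzero completed = class_of (\<lambda>_. 0)"
  by (simp add: nspace_completion_def)

lemma vadd_completion:
  assumes "s \<in> cauchy_seqs nspace" "t \<in> cauchy_seqs nspace"
  shows "vadd completed (class_of s) (class_of t) = class_of (\<lambda>n. s n + t n)"
proof -
  have "class_of (\<lambda>n. s n + t n) = class_of (\<lambda>n. s' n + t' n)"
    if "(s, s') \<in> cauchy_rel nspace" "(t, t') \<in> cauchy_rel nspace" for s s' t t'
  proof -
    from that have V: "s n \<in> V" "s' n \<in> V" "t n \<in> V" "t' n \<in> V" for n
      by (simp_all add: cauchy_rel_iff cauchy_seqs_in)
    from that have "(\<lambda>n. p (s n - s' n) + p (t n - t' n)) \<longlonglongrightarrow> 0"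
      unfolding cauchy_rel_iff by (intro tendsto_add_zero) auto
    then have "(\<lambda>n. p (s n + t n - (s' n + t' n))) \<longlonglongrightarrow> 0"
      by (rule tendsto_zero_dominated) (intro norm_nonneg norm_diff_add in_V V)+
    then show ?thesis
      using that by (simp add: class_eq_iff cauchy_rel_iff cauchy_seqs_add)
  qed
  then have "(\<lambda>s t. class_of (\<lambda>n. s n + t n)) respects2 cauchy_rel nspace"
    unfolding congruent2_def by blast
  from UN_equiv_class2[OF equiv_cauchy_rel equiv_cauchy_rel this assms] show ?thesis
    by (simp add: nspace_completion_def)
qed

lemma vscale_completion:
  assumes "s \<in> cauchy_seqs nspace"
  shows "vscale completed c (class_of s) = class_of (\<lambda>n. scale c (s n))"
proof -
  have "class_of (\<lambda>n. scale c (s n)) = class_of (\<lambda>n. scale c (s' n))"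
    if "(s, s') \<in> cauchy_rel nspace" for s s'
  proof -
    from that have "(\<lambda>n. norm c * p (s n - s' n)) \<longlonglongrightarrow> norm c * 0"
      unfolding cauchy_rel_iff by (intro tendsto_mult_left) auto
    then have "(\<lambda>n. p (scale c (s n) - scale c (s' n))) \<longlonglongrightarrow> 0"
      using that by (simp add: norm_scale in_V cauchy_seqs_in cauchy_rel_iff flip: scale_right_diff_distrib)
    then show ?thesis
      using that by (simp add: class_eq_iff cauchy_rel_iff cauchy_seqs_scale)
  qed
  then have "(\<lambda>s. class_of (\<lambda>n. scale c (s n))) respects cauchy_rel nspace"
    unfolding congruent_def by blast
  from UN_equiv_class[OF equiv_cauchy_rel this assms] show ?thesis
    by (simp add: nspace_completion_def)
qed

lemma norm_diff_ge: "x \<in> V \<Longrightarrow> y \<in> V \<Longrightarrow> \<bar>p x - p y\<bar> \<le> p (x - y)"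
  using triangle[of "x - y" y] triangle[of "y - x" x] norm_diff_commute[of x y]
  by (simp add: in_V abs_le_iff)

lemma vnorm_completion:
  assumes s: "s \<in> cauchy_seqs nspace"
  shows "(\<lambda>n. p (s n)) \<longlonglongrightarrow> vnorm completed (class_of s)"
proof -
  have "Cauchy (\<lambda>n. p (s n))"
    unfolding Cauchy_def dist_real_def
    using s norm_diff_ge by (meson cauchy_seqs_iff le_less_trans)
  then obtain r where r: "(\<lambda>n. p (s n)) \<longlonglongrightarrow> r"
    by (auto simp: Cauchy_convergent_iff convergent_def)
  have t: "(\<lambda>n. p (t n)) \<longlonglongrightarrow> r" if "t \<in> class_of s" for t
  proof (rule Lim_transform2[OF r])
    from that have st: "(\<lambda>n. p (s n - t n)) \<longlonglongrightarrow> 0" and t: "t \<in> cauchy_seqs nspace"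
      by (auto simp: cauchy_rel_iff)
    have "(\<lambda>n. \<bar>p (s n) - p (t n)\<bar>) \<longlonglongrightarrow> 0"
      using st
      by (rule tendsto_zero_dominated) (intro abs_ge_zero norm_diff_ge cauchy_seqs_in s t)+
    then show "(\<lambda>n. p (s n) - p (t n)) \<longlonglongrightarrow> 0"
      by (rule tendsto_rabs_zero_cancel)
  qed
  have "vnorm completed (class_of s) = r"
    unfolding nspace_completion_def nspace.select_convs nspace_simps
  proof (rule the_equality)
    show "r' = r" if "\<forall>t\<in>class_of s. (\<lambda>n. p (t n)) \<longlonglongrightarrow> r'" for r'
      using that class_self[OF s] r LIMSEQ_unique by blast
  qed (use t in blast)
  with r show ?thesis by simp
qed

lemma vnorm_completion_const: "v \<in> V \<Longrightarrow> vnorm completed (class_of (\<lambda>_. v)) = p v"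
  using LIMSEQ_unique[OF vnorm_completion[OF cauchy_seqs_const] tendsto_const] .

lemma definite_completion: "definite_nspace completed"
  unfolding definite_nspace_def
proof (intro conjI ballI)
  note 0 = cauchy_seqs_const[OF in_V(4)]
  show "vzero completed \<in> points completed"
    using 0 by (auto simp: points_completion vzero_completion)
  show "vadd completed (vzero completed) (vzero completed) = vzero completed"
    by (simp add: vzero_completion vadd_completion 0)
  show "vnorm completed (vzero completed) = 0"
    by (simp add: vzero_completion vnorm_completion_const in_V)
  fix P assume "P \<in> points completed - {vzero completed}"
  then obtain s where s: "s \<in> cauchy_seqs nspace" "P = class_of s" "P \<noteq> class_of (\<lambda>_. 0)"
    by (auto simp: points_completion vzero_completion)
  have "0 \<le> vnorm completed P"
    using vnorm_completion[OF s(1)] norm_nonneg cauchy_seqs_in[OF s(1)] s(2)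
    by (auto intro: LIMSEQ_le_const)
  moreover have "vnorm completed P \<noteq> 0"
    using vnorm_completion[OF s(1)] s class_eq_iff[OF s(1) 0] by auto
  ultimately show "0 < vnorm completed P" by simp
qed

text \<open>
The correspondence between forms on a space and forms on its completion.  Both directions of the
correspondence, and the preservation of bounds, are stated through this single relation, so that
no particular construction of the extended form has to be remembered.
\<close>

definition continuous_extension :: "('v \<Rightarrow> 'k) \<Rightarrow> ((nat \<Rightarrow> 'v) set \<Rightarrow> 'k) \<Rightarrow> bool" where
  "continuous_extension f g \<longleftrightarrow> (\<forall>s\<in>cauchy_seqs nspace. (\<lambda>n. f (s n)) \<longlonglongrightarrow> g (class_of s))"

lemma continuous_extension_const:
  assumes "continuous_extension f g" "v \<in> V"
  shows "g (class_of (\<lambda>_. v)) = f v"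
proof -
  have "(\<lambda>_. f v) \<longlonglongrightarrow> g (class_of (\<lambda>_. v))"
    using assms(1) cauchy_seqs_const[OF assms(2)] unfolding continuous_extension_def by fast
  then show ?thesis by (simp add: LIMSEQ_const_iff)
qed

text \<open>
Bounds pass to the completion as limits of inequalities, and back by evaluation at constant
sequences.
\<close>

lemma continuous_extension_bound:
  assumes "continuous_extension f g"
  shows "form_bound nspace f C \<longleftrightarrow> form_bound completed g C"
proof
  assume f: "form_bound nspace f C"
  show "form_bound completed g C"
    unfolding form_bound_def
  proof
    fix P assume "P \<in> points completed"
    then obtain s where s: "s \<in> cauchy_seqs nspace" "P = class_of s"
      by (auto simp: points_completion)
    have "(\<lambda>n. norm (f (s n))) \<longlonglongrightarrow> norm (g P)"
      using assms s by (auto simp: continuous_extension_def intro: tendsto_norm)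
    moreover have "(\<lambda>n. C * p (s n)) \<longlonglongrightarrow> C * vnorm completed P"
      unfolding s(2) by (intro tendsto_mult_left vnorm_completion s)
    ultimately show "norm (g P) \<le> C * vnorm completed P"
      using f s by (intro LIMSEQ_le) (auto simp: form_bound_iff cauchy_seqs_in)
  qed
next
  assume g: "form_bound completed g C"
  show "form_bound nspace f C"
    unfolding form_bound_iff
  proof
    fix v assume v: "v \<in> V"
    then have "class_of (\<lambda>_. v) \<in> points completed"
      using cauchy_seqs_const by (auto simp: points_completion)
    then show "norm (f v) \<le> C * p v"
      using g v unfolding form_bound_def
      by (metis continuous_extension_const[OF assms] vnorm_completion_const)
  qed
qed

lemma continuous_extension_norm:
  assumes "continuous_extension f g" "linear_form_on nspace f" "linear_form_on completed g"
  shows "form_norm completed g = form_norm nspace f"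
    and "bounded_linear_form_on completed g \<longleftrightarrow> bounded_linear_form_on nspace f"
proof -
  show "form_norm completed g = form_norm nspace f"
    using assms definite_nspace definite_completion continuous_extension_bound[OF assms(1)]
    by (intro form_norm_eq_if_same_bounds) auto
  show "bounded_linear_form_on completed g \<longleftrightarrow> bounded_linear_form_on nspace f"
    using assms(2,3) continuous_extension_bound[OF assms(1)]
    by (simp add: bounded_linear_form_on_iff definite_nspace definite_completion)
qed

lemma bounded_form_extends_to_completion:
  assumes f: "bounded_linear_form_on nspace f"
  obtains g where "bounded_linear_form_on completed g" "continuous_extension f g"
    "form_norm completed g = form_norm nspace f"
proof -
  obtain C where lin: "linear_form_on nspace f" and C: "form_bound nspace f C"
    using f definite_nspace by (auto simp: bounded_linear_form_on_iff)
  have f_diff: "f (x - y) = f x - f y" if "x \<in> V" "y \<in> V" for x y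
  proof -
    have "f (x + scale (- 1) y) = f x + - 1 * f y"
      using that lin in_V(3)[of y "- 1"] unfolding linear_form_iff by metis
    then show ?thesis by simp
  qed
  have f_le: "dist (f x) (f y) \<le> \<bar>C\<bar> * p (x - y)" if "x \<in> V" "y \<in> V" for x y
  proof -
    have "norm (f (x - y)) \<le> C * p (x - y)"
      using C that in_V unfolding form_bound_iff by blast
    also have "\<dots> \<le> \<bar>C\<bar> * p (x - y)"
      using that by (intro mult_right_mono norm_nonneg in_V) auto
    finally show ?thesis using that by (simp add: dist_norm f_diff)
  qed
  \<comment> \<open>Equivalent Cauchy sequences have images with the same limit, so the choice is harmless.\<close>
  define g where "g P = lim (\<lambda>n. f ((SOME s. s \<in> P) n))" for P
  have ext: "continuous_extension f g"
    unfolding continuous_extension_def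
  proof
    fix s assume s: "s \<in> cauchy_seqs nspace"
    define t where "t = (SOME t. t \<in> class_of s)"
    have "t \<in> class_of s" unfolding t_def using class_self[OF s] by (rule someI[of "\<lambda>t. t \<in> class_of s"])
    then have t: "t \<in> cauchy_seqs nspace" and st: "(\<lambda>n. p (s n - t n)) \<longlonglongrightarrow> 0"
      by (auto simp: cauchy_rel_iff)
    have "Cauchy (\<lambda>n. f (t n))"
      unfolding Cauchy_def
    proof (intro allI impI)
      fix e :: real assume "0 < e"
      then have "0 < e / (\<bar>C\<bar> + 1)" by (simp add: add_nonneg_pos)
      then obtain n0 where n0: "\<forall>m\<ge>n0. \<forall>n\<ge>n0. p (t m - t n) < e / (\<bar>C\<bar> + 1)"
        using t by (meson cauchy_seqs_iff)
      have "dist (f (t m)) (f (t n)) < e" if "m \<ge> n0" "n \<ge> n0" for m n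
      proof -
        have "dist (f (t m)) (f (t n)) \<le> (\<bar>C\<bar> + 1) * p (t m - t n)"
          using f_le[of "t m" "t n"] norm_nonneg[of "t m - t n"] t
          by (simp add: cauchy_seqs_in in_V distrib_right)
        also have "\<dots> < e"
          using n0 that by (simp add: pos_less_divide_eq add_nonneg_pos mult.commute)
        finally show ?thesis .
      qed
      then show "\<exists>n0. \<forall>m\<ge>n0. \<forall>n\<ge>n0. dist (f (t m)) (f (t n)) < e" by blast
    qed
    then have "(\<lambda>n. f (t n)) \<longlonglongrightarrow> g (class_of s)"
      unfolding g_def t_def[symmetric] using real_or_complex_complete convergent_LIMSEQ_iff by blast
    moreover have "(\<lambda>n. f (t n) - f (s n)) \<longlonglongrightarrow> 0"
    proof (rule tendsto_norm_zero_cancel, rule tendsto_zero_dominated)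
      show "(\<lambda>n. \<bar>C\<bar> * p (s n - t n)) \<longlonglongrightarrow> 0"
        using tendsto_mult_left[OF st] by simp
      show "norm (f (t n) - f (s n)) \<le> \<bar>C\<bar> * p (s n - t n)" for n
        using f_le[OF cauchy_seqs_in[OF s] cauchy_seqs_in[OF t]]
        by (simp add: dist_norm norm_minus_commute)
    qed simp
    ultimately show "(\<lambda>n. f (s n)) \<longlonglongrightarrow> g (class_of s)"
      by (rule Lim_transform2)
  qed
  have lin_g: "linear_form_on completed g"
    unfolding linear_form_on_def
  proof (intro conjI ballI allI)
    fix P Q assume "P \<in> points completed" "Q \<in> points completed"
    then obtain s t where *: "s \<in> cauchy_seqs nspace" "P = class_of s"
      "t \<in> cauchy_seqs nspace" "Q = class_of t"
      by (auto simp: points_completion)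
    have "(\<lambda>n. f (s n + t n)) \<longlonglongrightarrow> g (vadd completed P Q)"
      using ext cauchy_seqs_add[OF *(1,3)] by (simp add: continuous_extension_def * vadd_completion)
    moreover have "(\<lambda>n. f (s n + t n)) = (\<lambda>n. f (s n) + f (t n))"
      using lin * by (simp add: linear_form_iff cauchy_seqs_in)
    moreover have "(\<lambda>n. f (s n) + f (t n)) \<longlonglongrightarrow> g P + g Q"
      using ext * by (auto simp: continuous_extension_def intro: tendsto_add)
    ultimately show "g (vadd completed P Q) = g P + g Q"
      using LIMSEQ_unique by metis
  next
    fix c P assume "P \<in> points completed"
    then obtain s where *: "s \<in> cauchy_seqs nspace" "P = class_of s"
      by (auto simp: points_completion)
    have "(\<lambda>n. f (scale c (s n))) \<longlonglongrightarrow> g (vscale completed c P)"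
      using ext cauchy_seqs_scale[OF *(1)] by (simp add: continuous_extension_def * vscale_completion)
    moreover have "(\<lambda>n. f (scale c (s n))) = (\<lambda>n. c * f (s n))"
      using lin * by (simp add: linear_form_iff cauchy_seqs_in)
    moreover have "(\<lambda>n. c * f (s n)) \<longlonglongrightarrow> c * g P"
      using ext * by (auto simp: continuous_extension_def intro: tendsto_mult_left)
    ultimately show "g (vscale completed c P) = c * g P"
      using LIMSEQ_unique by metis
  qed
  show thesis
    using that[OF _ ext] continuous_extension_norm[OF ext lin lin_g] f by simp
qed

text \<open>
A Cauchy sequence converges, in the completion, to its own class: the distance of the class to
the \<open>m\<close>-th term is the limit of \<open>p (s m - s n)\<close> as \<open>n\<close> tends to infinity.  A bounded form on the
completion is therefore determined by its values on constant sequences.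
\<close>

lemma bounded_form_on_completion_restricts:
  assumes g: "bounded_linear_form_on completed g"
  obtains f where "bounded_linear_form_on nspace f" "continuous_extension f g"
    "form_norm completed g = form_norm nspace f"
proof -
  obtain C where lin: "linear_form_on completed g" and C: "form_bound completed g C"
    using g definite_completion by (auto simp: bounded_linear_form_on_iff)
  define f where "f v = g (class_of (\<lambda>_. v))" for v
  have point: "class_of s \<in> points completed" if "s \<in> cauchy_seqs nspace" for s
    using that by (auto simp: points_completion)
  have g_add: "g (class_of (\<lambda>n. s n + t n)) = g (class_of s) + g (class_of t)"
    if "s \<in> cauchy_seqs nspace" "t \<in> cauchy_seqs nspace" for s t
    unfolding vadd_completion[OF that, symmetric]
    using lin point[OF that(1)] point[OF that(2)] unfolding linear_form_on_def by blast
  have g_scale: "g (class_of (\<lambda>n. scale c (s n))) = c * g (class_of s)"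
    if "s \<in> cauchy_seqs nspace" for s c
    unfolding vscale_completion[OF that, symmetric]
    using lin point[OF that] unfolding linear_form_on_def by blast
  have lin_f: "linear_form_on nspace f"
    unfolding linear_form_iff
    using g_add[OF cauchy_seqs_const cauchy_seqs_const] g_scale[OF cauchy_seqs_const]
    by (simp add: f_def)
  have ext: "continuous_extension f g"
    unfolding continuous_extension_def
  proof (intro ballI LIMSEQ_I)
    fix s and e :: real assume s: "s \<in> cauchy_seqs nspace" and "0 < e"
    then have "0 < e / (\<bar>C\<bar> + 1)" by (simp add: add_nonneg_pos)
    then obtain n0 where n0: "\<forall>m\<ge>n0. \<forall>n\<ge>n0. p (s m - s n) < e / (\<bar>C\<bar> + 1)"
      using s by (meson cauchy_seqs_iff)
    have "norm (f (s m) - g (class_of s)) < e" if m: "m \<ge> n0" for m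
    proof -
      have sm: "(\<lambda>_. s m) \<in> cauchy_seqs nspace"
        using s by (intro cauchy_seqs_const cauchy_seqs_in)
      let ?d = "\<lambda>n. s m + scale (- 1) (s n)"
      have d: "?d \<in> cauchy_seqs nspace"
        by (intro cauchy_seqs_add[OF sm] cauchy_seqs_scale s)
      have lim: "vnorm completed (class_of ?d) \<le> e / (\<bar>C\<bar> + 1)"
      proof (rule LIMSEQ_le_const2[OF vnorm_completion[OF d]])
        show "\<exists>N. \<forall>n\<ge>N. p (?d n) \<le> e / (\<bar>C\<bar> + 1)"
          using n0 m by (auto intro!: exI[of _ n0] less_imp_le)
      qed
      have pos: "0 \<le> vnorm completed (class_of ?d)"
        using vnorm_completion[OF d] norm_nonneg[OF cauchy_seqs_in[OF d]]
        by (intro LIMSEQ_le_const) auto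
      have "f (s m) - g (class_of s) = g (class_of ?d)"
        unfolding g_add[OF sm cauchy_seqs_scale[OF s]] g_scale[OF s] by (simp add: f_def)
      then have "norm (f (s m) - g (class_of s)) \<le> C * vnorm completed (class_of ?d)"
        using C point[OF d] by (simp add: form_bound_def)
      also have "\<dots> \<le> \<bar>C\<bar> * vnorm completed (class_of ?d)"
        using pos by (intro mult_right_mono) auto
      also have "\<dots> \<le> \<bar>C\<bar> * (e / (\<bar>C\<bar> + 1))"
        using lim by (intro mult_left_mono) auto
      also have "\<dots> < e"
        using \<open>0 < e\<close> by (simp add: field_simps add_nonneg_pos)
      finally show ?thesis .
    qed
    then show "\<exists>N. \<forall>n\<ge>N. norm (f (s n) - g (class_of s)) < e" by blast
  qed
  show thesis
    using that[OF _ ext] continuous_extension_norm[OF ext lin_f lin] g by simp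
qed

end

section \<open>The projective tensor product\<close>

definition bilinear_bound ::
    "'x::real_normed_vector set \<Rightarrow> 'y::real_normed_vector set \<Rightarrow>
     ('x \<Rightarrow> 'y \<Rightarrow> 'k::real_normed_vector) \<Rightarrow> real \<Rightarrow> bool" where
  "bilinear_bound A B \<phi> C \<longleftrightarrow> (\<forall>x\<in>A. \<forall>y\<in>B. norm (\<phi> x y) \<le> C * (norm x * norm y))"

locale normed_space_pair =
  X: normed_space_over sX + Y: normed_space_over sY
  for sX :: "'k::real_or_complex \<Rightarrow> 'x::real_normed_vector \<Rightarrow> 'x"
    and sY :: "'k \<Rightarrow> 'y::real_normed_vector \<Rightarrow> 'y"
begin

sublocale XM: normed_manifold sX UNIV norm
  by unfold_locales (simp_all add: X.norm_scale norm_triangle_ineq)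

sublocale YM: normed_manifold sY UNIV norm
  by unfold_locales (simp_all add: Y.norm_scale norm_triangle_ineq)

sublocale T: vector_space "tensor_scale :: 'k \<Rightarrow> ('k, 'x, 'y) tensor \<Rightarrow> ('k, 'x, 'y) tensor"
  by (rule vector_space_tensor_scale)

abbreviation tensor :: "'x \<Rightarrow> 'y \<Rightarrow> ('k, 'x, 'y) tensor" (infixl "\<otimes>" 70) where
  "x \<otimes> y \<equiv> simple_tensor sX sY x y"

abbreviation sum_tensor :: "('x \<times> 'y) list \<Rightarrow> ('k, 'x, 'y) tensor" where
  "sum_tensor ps \<equiv> (\<Sum>(x, y)\<leftarrow>ps. x \<otimes> y)"

abbreviation "tensor_space A B \<equiv> projective_tensor sX sY A B"

lemma tensor_space_simps [simp]:
  "points (tensor_space A B) = algebraic_tensor sX sY A B" "vadd (tensor_space A B) = (+)"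
  "vzero (tensor_space A B) = 0" "vscale (tensor_space A B) = tensor_scale"
  "vnorm (tensor_space A B) = projective_norm sX sY A B"
  by (simp_all add: projective_tensor_def)

lemma tensor_add_left: "(x + x') \<otimes> y = x \<otimes> y + x' \<otimes> y"
  and tensor_add_right: "x \<otimes> (y + y') = x \<otimes> y + x \<otimes> y'"
  and tensor_scale_left: "sX c x \<otimes> y = tensor_scale c (x \<otimes> y)"
  and tensor_scale_right: "x \<otimes> sY c y = tensor_scale c (x \<otimes> y)"
  by (auto simp: simple_tensor_def tensor_scale_def bilinear_form_on_def fun_eq_iff)

lemma tensor_zero: "0 \<otimes> y = 0" "x \<otimes> 0 = 0"
  using tensor_add_left[of 0 0 y] tensor_add_right[of x 0 0] by simp_all

lemma scale_sum_tensor: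
  "tensor_scale c (sum_tensor ps) = sum_tensor (map (\<lambda>(x, y). (sX c x, y)) ps)"
proof (induction ps)
  case Nil
  show ?case by (simp only: list.map sum_list.Nil T.scale_zero_right)
next
  case (Cons a ps)
  then show ?case
    by (cases a) (simp only: list.map sum_list.Cons prod.case T.scale_right_distrib tensor_scale_left)
qed

lemma sum_tensor_eval:
  assumes "bilinear_form_on sX sY UNIV UNIV \<phi>"
  shows "sum_tensor ps \<phi> = (\<Sum>(x, y)\<leftarrow>ps. \<phi> x y)"
  by (induction ps) (use assms in \<open>auto simp: simple_tensor_def\<close>)

lemma bilinear_product_form:
  assumes "linear_form_on XM.nspace f" "linear_form_on YM.nspace g"
  shows "bilinear_form_on sX sY UNIV UNIV (\<lambda>x y. f x * g y)"
  using assms by (simp add: bilinear_form_on_def XM.linear_form_iff YM.linear_form_iff algebra_simps)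

text \<open>
If \<open>z\<close> is a combination of the first factors, then \<open>z \<otimes> y\<close> can be distributed over the existing
terms by changing their second factors only.  The first factors are kept in place so that the
induction on the combination can be iterated.
\<close>

lemma absorb_tensor:
  assumes "z \<in> X.span (fst ` set ps)"
  shows "\<exists>qs. map fst qs = map fst ps \<and> z \<otimes> y + sum_tensor ps = sum_tensor qs"
  using assms
proof (induction rule: X.span_induct_alt)
  case base
  show ?case by (intro exI[of _ ps]) (simp add: tensor_zero)
next
  case (step c x z)
  then obtain qs where qs: "map fst qs = map fst ps" "z \<otimes> y + sum_tensor ps = sum_tensor qs"
    by blast
  have "x \<in> fst ` set qs"
    using step(1) qs(1) by (metis list.set_map)
  then obtain us y' vs where split: "qs = us @ (x, y') # vs"
    by (auto simp: in_set_conv_decomp)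
  let ?qs = "us @ (x, y' + sY c y) # vs"
  have "(sX c x + z) \<otimes> y + sum_tensor ps = x \<otimes> sY c y + sum_tensor qs"
    by (simp add: tensor_add_left tensor_scale_left tensor_scale_right add.assoc flip: qs(2))
  also have "\<dots> = sum_tensor ?qs"
    by (simp add: split tensor_add_right algebra_simps)
  finally show ?case
    using qs(1) by (intro exI[of _ ?qs]) (simp add: split)
qed

text \<open>
Tensors are separated by products of bounded forms.  A representation is shortened until its
leading first factor \<open>x\<close> lies outside the span of the others and its second factor \<open>y\<close> is nonzero:
if \<open>x\<close> lies in the span, its term is absorbed by the others, and if \<open>y = 0\<close> it is dropped.
Then a form \<open>f\<close> that annihilates the other first factors but not \<open>x\<close>, and a form \<open>g\<close> that does
not vanish at \<open>y\<close>, leave exactly the term \<open>f x * g y\<close>.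
\<close>

lemma product_forms_separate:
  assumes "sum_tensor ps \<noteq> 0"
  shows "\<exists>f g. bounded_linear_form_on XM.nspace f \<and> bounded_linear_form_on YM.nspace g \<and>
    sum_tensor ps (\<lambda>x y. f x * g y) \<noteq> 0"
  using assms
proof (induction ps rule: length_induct)
  case (1 ps)
  show ?case
  proof (cases ps)
    case Nil
    then show ?thesis using 1(2) by simp
  next
    case (Cons a qs)
    obtain x y where a: "a = (x, y)" by (cases a)
    show ?thesis
    proof (cases "x \<in> X.span (fst ` set qs)")
      case True
      then obtain rs where rs: "map fst rs = map fst qs" "x \<otimes> y + sum_tensor qs = sum_tensor rs"
        using absorb_tensor by blast
      have "length rs < length ps" using map_eq_imp_length_eq[OF rs(1)] by (simp add: Cons)
      moreover have eq: "sum_tensor ps = sum_tensor rs" using rs(2) by (simp add: Cons a)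
      moreover have "sum_tensor rs \<noteq> 0" using 1(2) unfolding eq .
      ultimately show ?thesis using 1(1) unfolding eq by blast
    next
      case x: False
      show ?thesis
      proof (cases "y = 0")
        case True
        then have eq: "sum_tensor ps = sum_tensor qs" by (simp add: Cons a tensor_zero)
        moreover have "length qs < length ps" by (simp add: Cons)
        moreover have "sum_tensor qs \<noteq> 0" using 1(2) unfolding eq .
        ultimately show ?thesis using 1(1) unfolding eq by blast
      next
        case False
        obtain f where f: "bounded_linear_form_on XM.nspace f"
            "\<And>z. z \<in> set (map fst qs) \<Longrightarrow> f z = 0" "f x \<noteq> 0"
          using XM.annihilating_form[of "map fst qs" x] x by auto
        obtain g where g: "bounded_linear_form_on YM.nspace g" "g y \<noteq> 0"
          using YM.annihilating_form[of "[]" y] False by auto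
        have "(\<Sum>(x, y)\<leftarrow>qs. f x * g y) = (\<Sum>_\<leftarrow>qs. 0)"
          using f(2) by (intro arg_cong[of _ _ sum_list] map_cong) force+
        then have "sum_tensor ps (\<lambda>x y. f x * g y) = f x * g y"
          using f(1) g(1)
          by (subst sum_tensor_eval)
            (auto simp: Cons a bounded_linear_form_on_def intro: bilinear_product_form)
        then show ?thesis using f g by (intro exI[of _ f] exI[of _ g]) auto
      qed
    qed
  qed
qed

lemma tensor_nonzero:
  assumes "x \<noteq> 0" "y \<noteq> 0"
  shows "x \<otimes> y \<noteq> 0"
proof -
  obtain f where f: "bounded_linear_form_on XM.nspace f" "f x \<noteq> 0"
    using XM.annihilating_form[of "[]" x] assms by auto
  obtain g where g: "bounded_linear_form_on YM.nspace g" "g y \<noteq> 0"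
    using YM.annihilating_form[of "[]" y] assms by auto
  have "(x \<otimes> y) (\<lambda>x y. f x * g y) = f x * g y"
    using f g by (simp add: simple_tensor_def bilinear_product_form bounded_linear_form_on_def)
  then show ?thesis using f g by auto
qed

context
  fixes A :: "'x set" and B :: "'y set"
  assumes A: "X.subspace A" and B: "Y.subspace B"
begin

abbreviation "AB \<equiv> algebraic_tensor sX sY A B"
abbreviation "pnorm \<equiv> projective_norm sX sY A B"

lemma subspace_tensors: "T.subspace AB"
  unfolding algebraic_tensor_def by (rule T.subspace_span)

lemma tensor_in: "x \<in> A \<Longrightarrow> y \<in> B \<Longrightarrow> x \<otimes> y \<in> AB"
  unfolding algebraic_tensor_def by (rule T.span_base) blast

lemma sum_tensor_in: "set ps \<subseteq> A \<times> B \<Longrightarrow> sum_tensor ps \<in> AB"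
proof (induction ps)
  case Nil
  have "sum_tensor [] \<in> AB" using T.subspace_0[OF subspace_tensors] by simp
  then show ?case .
next
  case (Cons a ps)
  obtain x y where a: "a = (x, y)" by (cases a)
  have *: "set ps \<subseteq> A \<times> B" "x \<in> A" "y \<in> B" using Cons.prems by (auto simp: a)
  have "x \<otimes> y + sum_tensor ps \<in> AB"
    by (rule T.subspace_add[OF subspace_tensors tensor_in[OF *(2,3)] Cons.IH[OF *(1)]])
  then show ?case by (simp only: a list.map sum_list.Cons prod.case)
qed

lemma tensor_rep:
  assumes "F \<in> AB"
  obtains ps where "set ps \<subseteq> A \<times> B" "F = sum_tensor ps"
  using algebraic_tensor_rep[OF X.vector_space_axioms Y.vector_space_axioms A assms] by blast

lemma le_projective_norm:
  assumes "F \<in> AB"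
    and "\<And>ps. set ps \<subseteq> A \<times> B \<Longrightarrow> F = sum_tensor ps \<Longrightarrow> r \<le> (\<Sum>(x, y)\<leftarrow>ps. norm x * norm y)"
  shows "r \<le> pnorm F"
  unfolding projective_norm_def
proof (rule cInf_greatest)
  show "{\<Sum>(x, y)\<leftarrow>ps. norm x * norm y |ps. set ps \<subseteq> A \<times> B \<and> F = sum_tensor ps} \<noteq> {}"
    using algebraic_tensor_rep[OF X.vector_space_axioms Y.vector_space_axioms A assms(1)] by blast
qed (use assms(2) in blast)

lemma projective_norm_scale_le:
  assumes F: "F \<in> AB"
  shows "pnorm (tensor_scale c F) \<le> norm c * pnorm F"
proof (cases "c = 0")
  case True
  then show ?thesis using projective_norm_le[of "[]" A B sX sY] by simp
next
  case False
  have "pnorm (tensor_scale c F) / norm c \<le> pnorm F"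
  proof (rule le_projective_norm[OF F])
    fix ps assume ps: "set ps \<subseteq> A \<times> B" "F = sum_tensor ps"
    let ?qs = "map (\<lambda>(x, y). (sX c x, y)) ps"
    have "set ?qs \<subseteq> A \<times> B"
      using ps(1) X.subspace_scale[OF A] by auto
    from projective_norm_le[OF this, of sX sY]
    have "pnorm (sum_tensor ?qs) \<le> (\<Sum>(x, y)\<leftarrow>?qs. norm x * norm y)" .
    moreover have "sum_tensor ?qs = tensor_scale c F"
      by (simp only: ps(2) scale_sum_tensor)
    moreover have "(\<Sum>(x, y)\<leftarrow>?qs. norm x * norm y) = norm c * (\<Sum>(x, y)\<leftarrow>ps. norm x * norm y)"
      by (induction ps) (auto simp: X.norm_scale distrib_left)
    ultimately show "pnorm (tensor_scale c F) / norm c \<le> (\<Sum>(x, y)\<leftarrow>ps. norm x * norm y)"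
      using False by (simp add: divide_le_eq mult.commute)
  qed
  then show ?thesis using False by (simp add: divide_le_eq mult.commute)
qed

text \<open>
The universal property of the projective norm: a bound on elementary tensors is a bound on all
tensors, because it can be summed over any representation before taking the infimum.
\<close>

lemma tensor_form_bound:
  assumes l: "linear_form_on (tensor_space A B) l" and "0 \<le> C"
    and bound: "bilinear_bound A B (\<lambda>x y. l (x \<otimes> y)) C"
  shows "form_bound (tensor_space A B) l C"
  unfolding form_bound_def
proof
  fix F assume "F \<in> points (tensor_space A B)"
  then have F: "F \<in> AB" by simp
  have l0: "l 0 = 0"
    using l T.subspace_0[OF subspace_tensors] unfolding linear_form_on_def tensor_space_simps
    by (metis T.scale_zero_left mult_zero_left)
  have eval: "norm (l (sum_tensor ps)) \<le> C * (\<Sum>(x, y)\<leftarrow>ps. norm x * norm y)"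
    if "set ps \<subseteq> A \<times> B" for ps
    using that
  proof (induction ps)
    case Nil
    have "norm (l (sum_tensor [])) \<le> C * (\<Sum>(x, y)\<leftarrow>[]. norm x * norm y)"
      by (simp add: l0)
    then show ?case .
  next
    case (Cons a ps)
    obtain x y where a: "a = (x, y)" by (cases a)
    then have xy: "x \<in> A" "y \<in> B" using Cons by auto
    have "l (sum_tensor (a # ps)) = l (x \<otimes> y) + l (sum_tensor ps)"
      using l Cons.prems tensor_in[OF xy] sum_tensor_in[of ps] by (simp add: a linear_form_on_def)
    also have "norm \<dots> \<le> norm (l (x \<otimes> y)) + norm (l (sum_tensor ps))"
      by (rule norm_triangle_ineq)
    also have "\<dots> \<le> C * (norm x * norm y) + C * (\<Sum>(x, y)\<leftarrow>ps. norm x * norm y)"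
      using bound xy Cons by (intro add_mono) (auto simp: bilinear_bound_def)
    also have "\<dots> = C * (\<Sum>(x, y)\<leftarrow>a # ps. norm x * norm y)"
      by (simp add: a distrib_left)
    finally show ?case .
  qed
  show "norm (l F) \<le> C * vnorm (tensor_space A B) F"
  proof (cases "C = 0")
    case True
    obtain ps where "set ps \<subseteq> A \<times> B" "F = sum_tensor ps" using F by (rule tensor_rep)
    then show ?thesis using True eval[of ps] by simp
  next
    case False
    then have "0 < C" using \<open>0 \<le> C\<close> by simp
    have "norm (l F) / C \<le> pnorm F"
      using F
    proof (rule le_projective_norm)
      fix ps assume "set ps \<subseteq> A \<times> B" "F = sum_tensor ps"
      then show "norm (l F) / C \<le> (\<Sum>(x, y)\<leftarrow>ps. norm x * norm y)"
        using eval[of ps] \<open>0 < C\<close> by (simp add: divide_le_eq mult.commute)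
    qed
    then show ?thesis using \<open>0 < C\<close> by (simp add: divide_le_eq mult.commute)
  qed
qed

text \<open>
The projective norm is a norm and not merely a seminorm.  A nonzero tensor is detected by a
product of bounded forms, and evaluation at that product is bounded for the projective norm.
Without this, a form with bounded quotients could fail to be bounded.
\<close>

lemma projective_norm_definite:
  assumes F: "F \<in> AB" and zero: "pnorm F = 0"
  shows "F = 0"
proof (rule ccontr)
  assume "F \<noteq> 0"
  obtain ps where ps: "F = sum_tensor ps" using F by (rule tensor_rep)
  obtain f g where f: "bounded_linear_form_on XM.nspace f" and g: "bounded_linear_form_on YM.nspace g"
    and fg: "sum_tensor ps (\<lambda>x y. f x * g y) \<noteq> 0"
    using product_forms_separate[of ps] \<open>F \<noteq> 0\<close> ps by blast
  obtain C D where lin: "linear_form_on XM.nspace f" "linear_form_on YM.nspace g"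
    and C: "\<And>x. norm (f x) \<le> C * norm x" and D: "\<And>y. norm (g y) \<le> D * norm y"
    using f g XM.definite_nspace YM.definite_nspace
    by (auto simp: bounded_linear_form_on_iff XM.form_bound_iff YM.form_bound_iff)
  let ?\<phi> = "\<lambda>x y. f x * g y"
  have \<phi>: "bilinear_form_on sX sY UNIV UNIV ?\<phi>"
    using lin by (rule bilinear_product_form)
  have "form_bound (tensor_space A B) (\<lambda>G. G ?\<phi>) (\<bar>C\<bar> * \<bar>D\<bar>)"
  proof (rule tensor_form_bound)
    show "linear_form_on (tensor_space A B) (\<lambda>G. G ?\<phi>)"
      by (simp add: linear_form_on_def tensor_scale_def)
    show "bilinear_bound A B (\<lambda>x y. (x \<otimes> y) ?\<phi>) (\<bar>C\<bar> * \<bar>D\<bar>)"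
      unfolding bilinear_bound_def
    proof (intro ballI)
      fix x y
      have "norm (f x * g y) \<le> (\<bar>C\<bar> * norm x) * (\<bar>D\<bar> * norm y)"
        unfolding norm_mult
      proof (rule mult_mono)
        show "norm (f x) \<le> \<bar>C\<bar> * norm x"
          using C[of x] by (rule order_trans) (simp add: mult_right_mono)
        show "norm (g y) \<le> \<bar>D\<bar> * norm y"
          using D[of y] by (rule order_trans) (simp add: mult_right_mono)
      qed simp_all
      then show "norm ((x \<otimes> y) ?\<phi>) \<le> \<bar>C\<bar> * \<bar>D\<bar> * (norm x * norm y)"
        using \<phi> by (simp add: simple_tensor_def mult_ac)
    qed
  qed simp
  then have "norm (F ?\<phi>) \<le> 0"
    using F zero by (force simp: form_bound_def)
  then show False using fg ps by simp
qed

lemma normed_manifold_tensor: "normed_manifold tensor_scale AB pnorm"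
proof unfold_locales
  show "T.subspace AB" by (rule subspace_tensors)
  show "pnorm (F + G) \<le> pnorm F + pnorm G" if "F \<in> AB" "G \<in> AB" for F G
    by (rule projective_norm_triangle[OF X.vector_space_axioms Y.vector_space_axioms A that])
  show "F = 0" if "F \<in> AB" "pnorm F = 0" for F
    using that by (rule projective_norm_definite)
  show "pnorm (tensor_scale c F) = norm c * pnorm F" if F: "F \<in> AB" for c F
  proof (cases "c = 0")
    case True
    have "0 \<le> pnorm 0"
      using T.subspace_0[OF subspace_tensors]
      by (rule projective_norm_nonneg[OF X.vector_space_axioms Y.vector_space_axioms A])
    then show ?thesis using projective_norm_scale_le[OF F, of 0] True by simp
  next
    case False
    have "pnorm F = pnorm (tensor_scale (inverse c) (tensor_scale c F))"
      using False by simp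
    also have "\<dots> \<le> norm (inverse c) * pnorm (tensor_scale c F)"
      by (intro projective_norm_scale_le T.subspace_scale[OF subspace_tensors] F)
    finally have "norm c * pnorm F \<le> pnorm (tensor_scale c F)"
      using False unfolding norm_inverse by (simp add: field_simps)
    then show ?thesis using projective_norm_scale_le[OF F, of c] by simp
  qed
qed

lemma nspace_tensor: "normed_manifold.nspace tensor_scale AB pnorm = tensor_space A B"
  by (simp add: normed_manifold.nspace_def[OF normed_manifold_tensor] projective_tensor_def)

lemma definite_tensor_space: "definite_nspace (tensor_space A B)"
  using normed_manifold.definite_nspace[OF normed_manifold_tensor] by (simp add: nspace_tensor)

lemma bilinear_bound_iff_quotients:
  assumes \<phi>: "bilinear_form_on sX sY A B \<phi>"
  shows "bilinear_bound A B \<phi> C \<longleftrightarrow> (\<forall>q\<in>bilinear_quotients A B \<phi>. q \<le> C)"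
proof -
  have "(\<forall>q\<in>bilinear_quotients A B \<phi>. q \<le> C) \<longleftrightarrow>
      (\<forall>x\<in>A - {0}. \<forall>y\<in>B - {0}. norm (\<phi> x y) / (norm x * norm y) \<le> C)"
    by (auto simp: bilinear_quotients_def)
  also have "\<dots> \<longleftrightarrow> (\<forall>x\<in>A - {0}. \<forall>y\<in>B - {0}. norm (\<phi> x y) \<le> C * (norm x * norm y))"
    by (intro ball_cong refl) (simp add: pos_divide_le_eq)
  also have "\<dots> \<longleftrightarrow> bilinear_bound A B \<phi> C"
  proof -
    have "\<phi> (sX 0 x) y = 0 * \<phi> x y" "\<phi> x (sY 0 y) = 0 * \<phi> x y" if "x \<in> A" "y \<in> B" for x y
      using \<phi> that unfolding bilinear_form_on_def by blast+
    then have "\<phi> 0 y = 0" "\<phi> x 0 = 0" if "x \<in> A" "y \<in> B" for x y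
      using that by auto
    then show ?thesis
      unfolding bilinear_bound_def
      by (metis Diff_iff mult_zero_left mult_zero_right norm_zero order_refl singletonD)
  qed
  finally show ?thesis by simp
qed

text \<open>
From the linear form to the bilinear one the estimate \<open>pnorm (x \<otimes> y) \<le> norm x * norm y\<close>
suffices.  Both directions multiply an inequality by \<open>C\<close>, whose sign is settled by a pair of
nonzero vectors.
\<close>

lemma bilinear_linear_same_bounds:
  assumes nonzero: "A \<noteq> {0}" "B \<noteq> {0}"
    and \<phi>: "bilinear_form_on sX sY A B \<phi>" and f: "linear_form_on (tensor_space A B) f"
    and eq: "\<And>x y. x \<in> A \<Longrightarrow> y \<in> B \<Longrightarrow> f (x \<otimes> y) = \<phi> x y"
  shows "form_bound (tensor_space A B) f C \<longleftrightarrow> bilinear_bound A B \<phi> C"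
proof -
  obtain x0 y0 where xy0: "x0 \<in> A" "x0 \<noteq> 0" "y0 \<in> B" "y0 \<noteq> 0"
    using nonzero X.subspace_0[OF A] Y.subspace_0[OF B] by blast
  show ?thesis
  proof
    assume bound: "form_bound (tensor_space A B) f C"
    have "0 < pnorm (x0 \<otimes> y0)"
      using definite_tensor_space tensor_in[OF xy0(1,3)] tensor_nonzero[OF xy0(2,4)]
      by (simp add: definite_nspace_def)
    moreover have "norm (f (x0 \<otimes> y0)) \<le> C * pnorm (x0 \<otimes> y0)"
      using bound tensor_in[OF xy0(1,3)] by (simp add: form_bound_def)
    then have "0 \<le> C * pnorm (x0 \<otimes> y0)"
      by (rule order_trans[OF norm_ge_zero])
    ultimately have "0 \<le> C"
      by (simp add: zero_le_mult_iff)
    show "bilinear_bound A B \<phi> C"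
      unfolding bilinear_bound_def
    proof (intro ballI)
      fix x y assume xy: "x \<in> A" "y \<in> B"
      then have "norm (\<phi> x y) \<le> C * pnorm (x \<otimes> y)"
        using bound tensor_in[OF xy] by (simp add: form_bound_def flip: eq)
      also have "\<dots> \<le> C * (norm x * norm y)"
        using projective_norm_le[of "[(x, y)]" A B sX sY] xy \<open>0 \<le> C\<close>
        by (intro mult_left_mono) auto
      finally show "norm (\<phi> x y) \<le> C * (norm x * norm y)" .
    qed
  next
    assume bound: "bilinear_bound A B \<phi> C"
    then have "0 \<le> C * (norm x0 * norm y0)"
      using xy0 unfolding bilinear_bound_def by (meson norm_ge_zero order_trans)
    moreover have "0 < norm x0 * norm y0" using xy0 by simp
    ultimately have "0 \<le> C" by (metis mult_less_0_iff not_le)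
    then show "form_bound (tensor_space A B) f C"
      using bound by (intro tensor_form_bound f) (auto simp: bilinear_bound_def eq)
  qed
qed

lemma bilinear_linear_norms:
  assumes "A \<noteq> {0}" "B \<noteq> {0}"
    and \<phi>: "bilinear_form_on sX sY A B \<phi>" and f: "linear_form_on (tensor_space A B) f"
    and eq: "\<And>x y. x \<in> A \<Longrightarrow> y \<in> B \<Longrightarrow> f (x \<otimes> y) = \<phi> x y"
  shows "bounded_linear_form_on (tensor_space A B) f \<longleftrightarrow> bounded_bilinear_form_on sX sY A B \<phi>"
    and "form_norm (tensor_space A B) f = bilinear_form_norm A B \<phi>"
proof -
  have same: "(\<forall>q\<in>form_quotients (tensor_space A B) f. q \<le> C) \<longleftrightarrow>
      (\<forall>q\<in>bilinear_quotients A B \<phi>. q \<le> C)" for C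
    using bilinear_linear_same_bounds[OF assms] form_bound_iff_quotients[OF definite_tensor_space f]
      bilinear_bound_iff_quotients[OF \<phi>] by simp
  show "form_norm (tensor_space A B) f = bilinear_form_norm A B \<phi>"
    unfolding form_norm_def bilinear_form_norm_def by (rule Sup_eq_if_same_upper_bounds) (rule same)
  show "bounded_linear_form_on (tensor_space A B) f \<longleftrightarrow> bounded_bilinear_form_on sX sY A B \<phi>"
    using \<phi> f by (simp add: bounded_linear_form_on_def bounded_bilinear_form_on_def bdd_above_def same)
qed

lemma linearization:
  assumes "bilinear_form_on sX sY A B \<phi>"
  obtains f where "linear_form_on (tensor_space A B) f"
    "\<And>x y. x \<in> A \<Longrightarrow> y \<in> B \<Longrightarrow> f (x \<otimes> y) = \<phi> x y"
proof -
  obtain f where f: "Vector_Spaces.linear tensor_scale (*) f"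
    "\<And>x y. x \<in> A \<Longrightarrow> y \<in> B \<Longrightarrow> f (x \<otimes> y) = \<phi> x y"
    using algebraic_tensor_universal[OF X.vector_space_axioms Y.vector_space_axioms A B assms] by blast
  then interpret Vector_Spaces.linear tensor_scale "(*)" f by simp
  show thesis
    by (rule that[of f]) (use f in \<open>simp_all add: linear_form_on_def add scale\<close>)
qed

lemma bilinear_restriction:
  assumes f: "linear_form_on (tensor_space A B) f"
  shows "bilinear_form_on sX sY A B (\<lambda>x y. f (x \<otimes> y))"
  using f tensor_in
  by (simp add: bilinear_form_on_def linear_form_on_def tensor_add_left tensor_add_right
      tensor_scale_left tensor_scale_right)

text \<open>
Forms that agree on elementary tensors differ by a form with the bound \<open>0\<close>.
\<close>

lemma linear_forms_eq:
  assumes f: "linear_form_on (tensor_space A B) f" and g: "linear_form_on (tensor_space A B) g"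
    and eq: "\<And>x y. x \<in> A \<Longrightarrow> y \<in> B \<Longrightarrow> f (x \<otimes> y) = g (x \<otimes> y)" and F: "F \<in> AB"
  shows "f F = g F"
proof -
  have "linear_form_on (tensor_space A B) (\<lambda>F. f F - g F)"
    using f g by (simp add: linear_form_on_def algebra_simps)
  then have "form_bound (tensor_space A B) (\<lambda>F. f F - g F) 0"
    by (rule tensor_form_bound) (simp_all add: bilinear_bound_def eq)
  then show ?thesis using F by (simp add: form_bound_def)
qed

lemma tensor_space_nonzero:
  assumes "A \<noteq> {0}" "B \<noteq> {0}"
  shows "points (tensor_space A B) \<noteq> {vzero (tensor_space A B)}"
proof -
  obtain x y where "x \<in> A" "x \<noteq> 0" "y \<in> B" "y \<noteq> 0"
    using assms X.subspace_0[OF A] Y.subspace_0[OF B] by blast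
  then show ?thesis
    using tensor_in[of x y] tensor_nonzero[of x y] by auto
qed

end

section \<open>Extension of forms from a pair of subspaces\<close>

context
  fixes M :: "'x set" and N :: "'y set"
  assumes M: "X.subspace M" "M \<noteq> {0}" and N: "Y.subspace N" "N \<noteq> {0}"
begin

abbreviation "MN \<equiv> tensor_space M N"
abbreviation "XY \<equiv> tensor_space UNIV UNIV"

interpretation MN: normed_manifold tensor_scale "algebraic_tensor sX sY M N" "projective_norm sX sY M N"
  rewrites "normed_manifold.nspace tensor_scale (algebraic_tensor sX sY M N) (projective_norm sX sY M N) = MN"
proof -
  show "normed_manifold tensor_scale (algebraic_tensor sX sY M N) (projective_norm sX sY M N)"
    by (rule normed_manifold_tensor[OF M(1) N(1)])
qed (rule nspace_tensor[OF M(1) N(1)])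

interpretation XY: normed_manifold tensor_scale "algebraic_tensor sX sY UNIV UNIV"
    "projective_norm sX sY UNIV UNIV"
  rewrites "normed_manifold.nspace tensor_scale (algebraic_tensor sX sY UNIV UNIV)
      (projective_norm sX sY UNIV UNIV) = XY"
proof -
  show "normed_manifold tensor_scale (algebraic_tensor sX sY UNIV UNIV) (projective_norm sX sY UNIV UNIV)"
    by (rule normed_manifold_tensor[OF X.subspace_UNIV Y.subspace_UNIV])
qed (rule nspace_tensor[OF X.subspace_UNIV Y.subspace_UNIV])

lemma tensors_subset: "points MN \<subseteq> points XY"
  unfolding tensor_space_simps algebraic_tensor_def by (rule T.span_mono) auto

lemma nonzero_UNIV: "(UNIV :: 'x set) \<noteq> {0}" "(UNIV :: 'y set) \<noteq> {0}"
  using M(2) N(2) X.subspace_0[OF M(1)] Y.subspace_0[OF N(1)] by auto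

lemma MN_nonzero: "points MN \<noteq> {vzero MN}" and XY_nonzero: "points XY \<noteq> {vzero XY}"
  by (rule tensor_space_nonzero[OF M(1) N(1) M(2) N(2)],
      rule tensor_space_nonzero[OF X.subspace_UNIV Y.subspace_UNIV nonzero_UNIV])

text \<open>
Isometry makes a form on the small space obey the same bound with respect to the large norm, so
the Hahn-Banach theorem extends it.  Conversely a form of norm at most \<open>1\<close> that attains the small
norm of \<open>F\<close> extends to a form of norm at most \<open>1\<close>, which forces the large norm of \<open>F\<close> to be at
least as big; the other inequality holds because enlarging the spaces allows more representations.
\<close>

lemma isometric_iff_linear_extension:
  "(\<forall>F\<in>points MN. vnorm XY F = vnorm MN F) \<longleftrightarrow>
     (\<forall>f. bounded_linear_form_on MN f \<longrightarrow>
       (\<exists>f'. bounded_linear_form_on XY f' \<and> (\<forall>F\<in>points MN. f' F = f F) \<and>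
             form_norm XY f' = form_norm MN f))"
  (is "?isometric \<longleftrightarrow> ?extension")
proof
  assume isometric: ?isometric
  show ?extension
  proof (intro allI impI)
    fix f assume f: "bounded_linear_form_on MN f"
    let ?C = "form_norm MN f"
    have lin: "linear_form_on MN f" using f by (simp add: bounded_linear_form_on_def)
    have C: "0 \<le> ?C"
      by (rule form_norm_nonneg[OF MN.definite_nspace MN_nonzero f])
    have bound: "form_bound MN f ?C"
      by (rule form_bound_form_norm[OF MN.definite_nspace f])
    obtain g where g: "linear_form_on XY g" "form_bound XY g ?C"
      "\<And>F. F \<in> points MN \<Longrightarrow> g F = f F"
    proof (rule XY.hahn_banach[of "points MN" ?C f])
      show "T.subspace (points MN)" using MN.subspace_V by simp
      show "points MN \<subseteq> algebraic_tensor sX sY UNIV UNIV" using tensors_subset by simp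
      show "f (F + G) = f F + f G" if "F \<in> points MN" "G \<in> points MN" for F G
        using lin that by (simp add: linear_form_on_def)
      show "f (tensor_scale c F) = c * f F" if "F \<in> points MN" for c F
        using lin that by (simp add: linear_form_on_def)
      show "norm (f F) \<le> ?C * projective_norm sX sY UNIV UNIV F" if "F \<in> points MN" for F
        using bound isometric that by (simp add: form_bound_def)
      fix g assume "linear_form_on XY g" "form_bound XY g ?C" "\<And>F. F \<in> points MN \<Longrightarrow> g F = f F"
      then show thesis by (rule that)
    qed (rule C)
    have bounded: "bounded_linear_form_on XY g"
      using g(1,2) bounded_linear_form_on_iff[OF XY.definite_nspace] by blast
    moreover have "form_norm XY g = ?C"
    proof (rule antisym)
      show "form_norm XY g \<le> ?C"
        by (rule form_norm_le[OF XY.definite_nspace XY_nonzero g(1,2)])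
      have "norm (f F) \<le> form_norm XY g * vnorm MN F" if F: "F \<in> points MN" for F
      proof -
        have "F \<in> points XY" using F tensors_subset by blast
        then have "norm (g F) \<le> form_norm XY g * vnorm XY F"
          using form_bound_form_norm[OF XY.definite_nspace bounded] unfolding form_bound_def by blast
        moreover have "vnorm XY F = vnorm MN F" using isometric F by blast
        ultimately show ?thesis using g(3)[OF F] by (simp only:)
      qed
      then have "form_bound MN f (form_norm XY g)"
        unfolding form_bound_def by blast
      then show "?C \<le> form_norm XY g"
        by (rule form_norm_le[OF MN.definite_nspace MN_nonzero lin])
    qed
    ultimately show "\<exists>f'. bounded_linear_form_on XY f' \<and> (\<forall>F\<in>points MN. f' F = f F) \<and>
        form_norm XY f' = ?C"
      using g(3) by blast
  qed
next
  assume extension: ?extension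
  show ?isometric
  proof
    fix F assume F: "F \<in> points MN"
    have "vnorm XY F \<le> vnorm MN F"
      using projective_norm_mono[OF X.vector_space_axioms Y.vector_space_axioms M(1), of F N UNIV UNIV] F
      by simp
    moreover have "vnorm MN F \<le> vnorm XY F"
    proof (cases "F = 0")
      case False
      then obtain f where f: "linear_form_on MN f" "form_bound MN f 1" "f F = of_real (vnorm MN F)"
        using MN.norming_form[of F] F by auto
      then have "bounded_linear_form_on MN f"
        using bounded_linear_form_on_iff[OF MN.definite_nspace] by blast
      then obtain g where g: "bounded_linear_form_on XY g" "g F = f F" "form_norm XY g = form_norm MN f"
        using extension F by blast
      have "0 \<le> vnorm MN F" using MN.norm_nonneg F by simp
      then have "vnorm MN F = norm (g F)" by (simp add: g(2) f(3))
      also have "\<dots> \<le> form_norm XY g * vnorm XY F"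
        using form_bound_form_norm[OF XY.definite_nspace g(1)] F tensors_subset
        unfolding form_bound_def by blast
      also have "\<dots> \<le> 1 * vnorm XY F"
        using form_norm_le[OF MN.definite_nspace MN_nonzero f(1,2)] F tensors_subset XY.norm_nonneg[of F]
        unfolding g(3) by (intro mult_right_mono) auto
      finally show ?thesis by simp
    qed simp
    ultimately show "vnorm XY F = vnorm MN F" by simp
  qed
qed

text \<open>
Linearization is a norm preserving bijection between bounded bilinear forms and bounded linear
forms, for the pair of subspaces as well as for the pair of whole spaces, and it is compatible
with restriction because \<open>x \<otimes> y\<close> is the same tensor in both products.
\<close>

lemma bilinear_extension_iff_linear_extension:
  "(\<forall>\<phi>. bounded_bilinear_form_on sX sY M N \<phi> \<longrightarrow>
       (\<exists>\<phi>'. bounded_bilinear_form_on sX sY UNIV UNIV \<phi>' \<and>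
             (\<forall>x\<in>M. \<forall>y\<in>N. \<phi>' x y = \<phi> x y) \<and>
             bilinear_form_norm UNIV UNIV \<phi>' = bilinear_form_norm M N \<phi>)) \<longleftrightarrow>
   (\<forall>f. bounded_linear_form_on MN f \<longrightarrow>
       (\<exists>f'. bounded_linear_form_on XY f' \<and> (\<forall>F\<in>points MN. f' F = f F) \<and>
             form_norm XY f' = form_norm MN f))"
  (is "?bilinear \<longleftrightarrow> ?linear")
proof
  note norms_MN = bilinear_linear_norms[OF M(1) N(1) M(2) N(2)]
  note norms_XY = bilinear_linear_norms[OF X.subspace_UNIV Y.subspace_UNIV nonzero_UNIV]
  show ?linear if bilinear: ?bilinear
  proof (intro allI impI)
    fix f assume f: "bounded_linear_form_on MN f"
    then have lin: "linear_form_on MN f" by (simp add: bounded_linear_form_on_def)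
    let ?\<phi> = "\<lambda>x y. f (x \<otimes> y)"
    have \<phi>: "bilinear_form_on sX sY M N ?\<phi>"
      by (rule bilinear_restriction[OF M(1) N(1) lin])
    note norms_f = norms_MN[OF \<phi> lin refl]
    obtain \<psi> where \<psi>: "bounded_bilinear_form_on sX sY UNIV UNIV \<psi>"
      "\<And>x y. x \<in> M \<Longrightarrow> y \<in> N \<Longrightarrow> \<psi> x y = f (x \<otimes> y)"
      "bilinear_form_norm UNIV UNIV \<psi> = bilinear_form_norm M N ?\<phi>"
      using bilinear f norms_f(1) by blast
    then have bil: "bilinear_form_on sX sY UNIV UNIV \<psi>"
      by (simp add: bounded_bilinear_form_on_def)
    obtain g where g: "linear_form_on XY g" "\<And>x y. g (x \<otimes> y) = \<psi> x y"
      using linearization[OF X.subspace_UNIV Y.subspace_UNIV bil] by auto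
    note norms_g = norms_XY[OF bil g]
    have "F \<in> points XY" if "F \<in> points MN" for F
      using that tensors_subset by blast
    then have "linear_form_on MN g"
      using g(1) by (simp add: linear_form_on_def)
    then have agree: "g F = f F" if "F \<in> points MN" for F
      by (rule linear_forms_eq[OF M(1) N(1) _ lin]) (use that in \<open>simp_all add: g(2) \<psi>(2)\<close>)
    have "bounded_linear_form_on XY g" by (rule iffD2[OF norms_g(1) \<psi>(1)])
    moreover have "form_norm XY g = form_norm MN f"
      by (rule trans[OF norms_g(2) trans[OF \<psi>(3) norms_f(2)[symmetric]]])
    ultimately show "\<exists>f'. bounded_linear_form_on XY f' \<and> (\<forall>F\<in>points MN. f' F = f F) \<and>
        form_norm XY f' = form_norm MN f"
      by (intro exI[of _ g] conjI ballI agree)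
  qed
  show ?bilinear if linear: ?linear
  proof (intro allI impI)
    fix \<phi> assume \<phi>: "bounded_bilinear_form_on sX sY M N \<phi>"
    then have bil: "bilinear_form_on sX sY M N \<phi>"
      by (simp add: bounded_bilinear_form_on_def)
    obtain f where f: "linear_form_on MN f"
      "\<And>x y. x \<in> M \<Longrightarrow> y \<in> N \<Longrightarrow> f (x \<otimes> y) = \<phi> x y"
      using linearization[OF M(1) N(1) bil] by blast
    note norms_f = norms_MN[OF bil f]
    obtain g where g: "bounded_linear_form_on XY g" "\<And>F. F \<in> points MN \<Longrightarrow> g F = f F"
      "form_norm XY g = form_norm MN f"
      using linear \<phi> norms_f(1) by blast
    then have lin: "linear_form_on XY g" by (simp add: bounded_linear_form_on_def)
    let ?\<psi> = "\<lambda>x y. g (x \<otimes> y)"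
    have \<psi>: "bilinear_form_on sX sY UNIV UNIV ?\<psi>"
      by (rule bilinear_restriction[OF X.subspace_UNIV Y.subspace_UNIV lin])
    note norms_g = norms_XY[OF \<psi> lin refl]
    have agree: "?\<psi> x y = \<phi> x y" if "x \<in> M" "y \<in> N" for x y
      using g(2)[of "x \<otimes> y"] tensor_in[OF M(1) N(1) that] f(2)[OF that] by simp
    have "bounded_bilinear_form_on sX sY UNIV UNIV ?\<psi>" by (rule iffD1[OF norms_g(1) g(1)])
    moreover have "bilinear_form_norm UNIV UNIV ?\<psi> = bilinear_form_norm M N \<phi>"
      by (rule trans[OF norms_g(2)[symmetric] trans[OF g(3) norms_f(2)]])
    ultimately show "\<exists>\<phi>'. bounded_bilinear_form_on sX sY UNIV UNIV \<phi>' \<and>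
        (\<forall>x\<in>M. \<forall>y\<in>N. \<phi>' x y = \<phi> x y) \<and>
        bilinear_form_norm UNIV UNIV \<phi>' = bilinear_form_norm M N \<phi>"
      by (intro exI[of _ ?\<psi>] conjI ballI agree)
  qed
qed

text \<open>
Restriction to the dense manifold and extension by continuity are mutually inverse and preserve
the norm.  They are compatible with the canonical map between the completions because that map
keeps the representing Cauchy sequence.
\<close>

lemma linear_extension_iff_completion_extension:
  "(\<forall>f. bounded_linear_form_on MN f \<longrightarrow>
       (\<exists>f'. bounded_linear_form_on XY f' \<and> (\<forall>F\<in>points MN. f' F = f F) \<and>
             form_norm XY f' = form_norm MN f)) \<longleftrightarrow>
   (\<forall>f. bounded_linear_form_on (nspace_completion MN) f \<longrightarrow>
       (\<exists>f'. bounded_linear_form_on (nspace_completion XY) f' \<and>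
             (\<forall>P\<in>points (nspace_completion MN). f' (completion_inclusion XY P) = f P) \<and>
             form_norm (nspace_completion XY) f' = form_norm (nspace_completion MN) f))"
  (is "?plain \<longleftrightarrow> ?complete")
proof
  note inclusion = completion_inclusion_class[OF X.vector_space_axioms Y.vector_space_axioms M(1)]
  show ?complete if plain: ?plain
  proof (intro allI impI)
    fix f assume f: "bounded_linear_form_on (nspace_completion MN) f"
    obtain f0 where f0: "bounded_linear_form_on MN f0" "MN.continuous_extension f0 f"
      "form_norm (nspace_completion MN) f = form_norm MN f0"
      using MN.bounded_form_on_completion_restricts[OF f] by blast
    obtain g0 where g0: "bounded_linear_form_on XY g0" "\<And>F. F \<in> points MN \<Longrightarrow> g0 F = f0 F"
      "form_norm XY g0 = form_norm MN f0"
      using plain f0(1) by blast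
    obtain g where g: "bounded_linear_form_on (nspace_completion XY) g" "XY.continuous_extension g0 g"
      "form_norm (nspace_completion XY) g = form_norm XY g0"
      using XY.bounded_form_extends_to_completion[OF g0(1)] by blast
    have "g (completion_inclusion XY P) = f P" if P: "P \<in> points (nspace_completion MN)" for P
    proof -
      obtain s where s: "s \<in> cauchy_seqs MN" "P = cauchy_rel MN `` {s}"
        using iffD1[OF MN.points_completion P] by blast
      have "(\<lambda>n. g0 (s n)) \<longlonglongrightarrow> g (completion_inclusion XY P)"
        using g(2) inclusion(1)[OF s(1)]
        unfolding s(2) inclusion(2)[OF s(1)] XY.continuous_extension_def by blast
      moreover have "(\<lambda>n. g0 (s n)) \<longlonglongrightarrow> f P"
      proof -
        have "g0 (s n) = f0 (s n)" for n
          by (rule g0(2)) (simp add: MN.cauchy_seqs_in[OF s(1)])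
        moreover have "(\<lambda>n. f0 (s n)) \<longlonglongrightarrow> f P"
          using f0(2) s(1) unfolding s(2) MN.continuous_extension_def by blast
        ultimately show ?thesis by (simp only:)
      qed
      ultimately show ?thesis by (rule LIMSEQ_unique)
    qed
    moreover have "form_norm (nspace_completion XY) g = form_norm (nspace_completion MN) f"
      by (rule trans[OF g(3) trans[OF g0(3) f0(3)[symmetric]]])
    ultimately show "\<exists>f'. bounded_linear_form_on (nspace_completion XY) f' \<and>
        (\<forall>P\<in>points (nspace_completion MN). f' (completion_inclusion XY P) = f P) \<and>
        form_norm (nspace_completion XY) f' = form_norm (nspace_completion MN) f"
      using g(1) by blast
  qed
  show ?plain if complete: ?complete
  proof (intro allI impI)
    fix f0 assume f0: "bounded_linear_form_on MN f0"
    obtain f where f: "bounded_linear_form_on (nspace_completion MN) f" "MN.continuous_extension f0 f"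
      "form_norm (nspace_completion MN) f = form_norm MN f0"
      using MN.bounded_form_extends_to_completion[OF f0] by blast
    obtain g where g: "bounded_linear_form_on (nspace_completion XY) g"
      "\<And>P. P \<in> points (nspace_completion MN) \<Longrightarrow> g (completion_inclusion XY P) = f P"
      "form_norm (nspace_completion XY) g = form_norm (nspace_completion MN) f"
      using complete f(1) by blast
    obtain g0 where g0: "bounded_linear_form_on XY g0" "XY.continuous_extension g0 g"
      "form_norm (nspace_completion XY) g = form_norm XY g0"
      using XY.bounded_form_on_completion_restricts[OF g(1)] by blast
    have "g0 F = f0 F" if F: "F \<in> points MN" for F
    proof -
      have c: "(\<lambda>_. F) \<in> cauchy_seqs MN" using MN.cauchy_seqs_const F by simp
      have "g0 F = g (cauchy_rel XY `` {\<lambda>_. F})"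
        using XY.continuous_extension_const[OF g0(2)] F tensors_subset by auto
      also have "\<dots> = g (completion_inclusion XY (cauchy_rel MN `` {\<lambda>_. F}))"
        using inclusion(2)[OF c] by simp
      also have "\<dots> = f (cauchy_rel MN `` {\<lambda>_. F})"
        using MN.points_completion c by (intro g(2)) blast
      also have "\<dots> = f0 F"
        using MN.continuous_extension_const[OF f(2)] F by simp
      finally show ?thesis .
    qed
    moreover have "form_norm XY g0 = form_norm MN f0"
      by (rule trans[OF g0(3)[symmetric] trans[OF g(3) f(3)]])
    ultimately show "\<exists>f'. bounded_linear_form_on XY f' \<and> (\<forall>F\<in>points MN. f' F = f0 F) \<and>
        form_norm XY f' = form_norm MN f0"
      using g0(1) by blast
  qed
qed

end

end

theorem corollary6p2:
  fixes sX :: "'k::real_or_complex \<Rightarrow> 'x::banach \<Rightarrow> 'x"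
    and sY :: "'k \<Rightarrow> 'y::banach \<Rightarrow> 'y"
    and M :: "'x set" and N :: "'y set"
  assumes "normed_space_over sX" and "normed_space_over sY"
    and "(UNIV :: 'x set) \<noteq> {0}" and "(UNIV :: 'y set) \<noteq> {0}"
    and "module.subspace sX M" and "closed M" and "M \<noteq> {0}"
    and "module.subspace sY N" and "closed N" and "N \<noteq> {0}"
  shows
    "let MN = projective_tensor sX sY M N;
         XY = projective_tensor sX sY UNIV UNIV;
         \<iota> = completion_inclusion XY;
         a = (\<forall>F\<in>points MN. vnorm XY F = vnorm MN F);
         b = (\<forall>\<phi>. bounded_bilinear_form_on sX sY M N \<phi> \<longrightarrow>
               (\<exists>\<phi>'. bounded_bilinear_form_on sX sY UNIV UNIV \<phi>' \<and>
                     (\<forall>x\<in>M. \<forall>y\<in>N. \<phi>' x y = \<phi> x y) \<and>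
                     bilinear_form_norm UNIV UNIV \<phi>' = bilinear_form_norm M N \<phi>));
         c = (\<forall>f. bounded_linear_form_on MN f \<longrightarrow>
               (\<exists>f'. bounded_linear_form_on XY f' \<and>
                     (\<forall>F\<in>points MN. f' F = f F) \<and>
                     form_norm XY f' = form_norm MN f));
         d = (\<forall>f. bounded_linear_form_on (nspace_completion MN) f \<longrightarrow>
               (\<exists>f'. bounded_linear_form_on (nspace_completion XY) f' \<and>
                     (\<forall>P\<in>points (nspace_completion MN). f' (\<iota> P) = f P) \<and>
                     form_norm (nspace_completion XY) f' = form_norm (nspace_completion MN) f))
     in (a \<longleftrightarrow> b) \<and> (b \<longleftrightarrow> c) \<and> (c \<longleftrightarrow> d)"
proof -
  interpret normed_space_pair sX sY
    using assms(1,2) by (simp add: normed_space_pair_def)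
  show ?thesis
    unfolding Let_def
    using isometric_iff_linear_extension[OF assms(5,7,8,10)]
      bilinear_extension_iff_linear_extension[OF assms(5,7,8,10)]
      linear_extension_iff_completion_extension[OF assms(5,7,8,10)]
    by (simp only: simp_thms)
qed

end
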